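(* Let $\mathbf g=(g_1,\dots,g_m)\in M^1(\mathbb R^n)\otimes\mathbb C^m$ generate a multi-window Gabor frame over $\Lambda_D$, and let $\alpha\in\mathbb C^m$ with $v_\alpha=\sum_s\overline{\alpha_s}\mathcal Z_Dg_s(0,0)\neq0$. Let $f\in\mathcal C_{\Lambda_D}$ and $\zeta\in\mathbb R^{2n}$, and assume $B_0^{(\zeta)}(f)\neq0$. Then for every $\lambda\in\Lambda_D$, $$\frac{\langle B_\lambda^{(\zeta)}(f),B_0^{(\zeta)}(f)\rangle}{\|B_0^{(\zeta)}(f)\|_{\ell^2(K_D)}^2}=\chi_D(\lambda)e^{2\pi i\sigma(\lambda,\zeta)} .$$ In particular, if $f=\psi_c\neq0$ (with $v_\alpha\ne0$), then $B_0^{(\zeta)}(\psi_c)\neq0$ for all sufficiently small displacements $\zeta$.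
   Context: Conventions: inner products and the $M^\infty$–$M^1$ pairing $\langle\cdot,\cdot\rangle$ (extending the $L^2$ inner product) are linear in the first and conjugate-linear in the second variable. $\rho(x,\omega)=e^{-\pi i x\cdot\omega}M_\omega T_x$ with $(T_xf)(t)=f(t-x)$, $(M_\omega f)(t)=e^{2\pi i\omega\cdot t}f(t)$; $\sigma((x,\omega),(x',\omega'))=x\cdot\omega'-\omega\cdot x'$. $M^p(\mathbb R^n)$ is the set of tempered distributions $f$ with $z\mapsto\langle f,\rho(z)\varphi\rangle$ in $L^p(\mathbb R^{2n})$ for a fixed nonzero Schwartz $\varphi$; $M^\infty$ is the dual of $M^1$, and $\langle\rho(z)\psi,h\rangle=\langle\psi,\rho(-z)h\rangle$. $D=\operatorname{diag}(d_1,\dots,d_n)$, positive integers $d_1\mid\cdots\mid d_n$, $d=\prod_jd_j$. $\Lambda_D=D^{1/2}\mathbb Z^n\times D^{1/2}\mathbb Z^n$, $\Lambda_D^\circ=D^{-1/2}\mathbb Z^n\times D^{-1/2}\mathbb Z^n$, $\chi_D(D^{1/2}k,D^{1/2}\ell)=(-1)^{k^TD\ell}$, $S_\lambda=\chi_D(\lambda)\rho(\lambda)$, $\mathcal C_{\Lambda_D}=\{\psi\in M^\infty(\mathbb R^n):S_\lambda\psi=\psi\ \forall\lambda\in\Lambda_D\}$. $\mathbb Z_{\mathbf d}=\prod_j\mathbb Z_{d_j}$, $\mathcal H_{\mathbf d}=\bigotimes_j\mathbb C^{d_j}$, $\delta_r=D^{-1/2}r$. For $h\in M^1(\mathbb R^n)$,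 $Z_Dh(x,\omega)=\sum_{\gamma\in D^{1/2}\mathbb Z^n}h(x-\gamma)e^{2\pi i\gamma\cdot\omega}$ and $(\mathcal Z_Dh(x,\omega))_r=e^{-2\pi i\delta_r\cdot\omega}Z_Dh(x+\delta_r,\omega)$, $r\in\mathbb Z_{\mathbf d}$. For $c\in\mathcal H_{\mathbf d}$, $\psi_c$ is the unique element of $\mathcal C_{\Lambda_D}$ with $\langle\psi_c,h\rangle=\langle c,\mathcal Z_Dh(0,0)\rangle$ for all $h\in M^1(\mathbb R^n)$. $K_D=\Lambda_D^\circ/\Lambda_D\cong\mathbb Z_{\mathbf d}\times\mathbb Z_{\mathbf d}$; for $q=(r,s)$ with fixed integer representatives, $\nu_q=(D^{-1/2}r,D^{-1/2}s)$. $\mathbf g$ generates a multi-window Gabor frame over $\Lambda_D$ if $\{\rho(\lambda)g_j:\lambda\in\Lambda_D,1\le j\le m\}$ is a frame of $L^2(\mathbb R^n)$. With $h_\alpha=\sum_s\overline{\alpha_s}g_s$, the adjoint-lattice coefficients of $F\in M^\infty(\mathbb R^n)$ are $a_{\mu,\alpha}(F)=\frac1d\langle F,\rho(\mu)h_\alpha\rangle$, $\mu\in\Lambda_D^\circ$, and the blocks are $$B_\lambda^{(\zeta)}(f)=\frac{\sqrt d}{\|v_\alpha\|}\Bigl(e^{\pi i\sigma(\lambda,\nu_q)}a_{\lambda+\nu_q,\alpha}(\rho(\zeta)f)\Bigr)_{q\in K_D}\in\ell^2(K_D).$$ *)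

theory Defs
  imports "HOL-Analysis.Analysis"
begin

section \<open>Time-frequency shifts\<close>

type_synonym 'n phase = "(real^'n) \<times> (real^'n)"

definition translate :: "real^'n \<Rightarrow> (real^'n \<Rightarrow> complex) \<Rightarrow> real^'n \<Rightarrow> complex" where
  "translate x f = (\<lambda>t. f (t - x))"

definition modulate :: "real^'n \<Rightarrow> (real^'n \<Rightarrow> complex) \<Rightarrow> real^'n \<Rightarrow> complex" where
  "modulate \<omega> f = (\<lambda>t. cis (2 * pi * (\<omega> \<bullet> t)) * f t)"

definition rho :: "'n::finite phase \<Rightarrow> (real^'n \<Rightarrow> complex) \<Rightarrow> real^'n \<Rightarrow> complex" where
  "rho z f = (\<lambda>t. cis (- (pi * (fst z \<bullet> snd z))) * modulate (snd z) (translate (fst z) f) t)"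

definition sympl :: "'n::finite phase \<Rightarrow> 'n::finite phase \<Rightarrow> real" where
  "sympl z w = fst z \<bullet> snd w - snd z \<bullet> fst w"


section \<open>Schwartz functions and tempered distributions\<close>

fun iter_partial :: "'n list \<Rightarrow> (real^'n \<Rightarrow> complex) \<Rightarrow> real^'n \<Rightarrow> complex" where
  "iter_partial [] f = f"
| "iter_partial (i # js) f = (\<lambda>x. frechet_derivative (iter_partial js f) (at x) (axis i 1))"

definition schwartz :: "(real^'n \<Rightarrow> complex) set" where
  "schwartz = {f. \<forall>js. (\<forall>x. iter_partial js f differentiable (at x)) \<and>
                 (\<forall>k. \<exists>C. \<forall>x. norm x ^ k * cmod (iter_partial js f x) \<le> C)}"

definition schwartz_norm :: "nat \<Rightarrow> (real^'n \<Rightarrow> complex) \<Rightarrow> real" where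
  "schwartz_norm N f =
     (\<Sum>js | length js \<le> N. SUP x. (1 + norm x) ^ N * cmod (iter_partial js f x))"

text \<open>
  Distributions act conjugate-linearly, so that \<open>u f\<close> is the pairing of \<open>u\<close> with \<open>f\<close>
  extending the \<open>L\<^sup>2\<close> inner product. Only the values on Schwartz functions matter.
\<close>

definition tempered_distribution :: "((real^'n \<Rightarrow> complex) \<Rightarrow> complex) \<Rightarrow> bool" where
  "tempered_distribution u \<longleftrightarrow>
     (\<forall>f\<in>schwartz. \<forall>g\<in>schwartz. u (\<lambda>t. f t + g t) = u f + u g) \<and>
     (\<forall>a. \<forall>f\<in>schwartz. u (\<lambda>t. a * f t) = cnj a * u f) \<and>
     (\<exists>N C. \<forall>f\<in>schwartz. cmod (u f) \<le> C * schwartz_norm N f)"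

definition L2_inner :: "(real^'n \<Rightarrow> complex) \<Rightarrow> (real^'n \<Rightarrow> complex) \<Rightarrow> complex" where
  "L2_inner f g = (LINT t|lborel. f t * cnj (g t))"

definition stft ::
  "(real^'n \<Rightarrow> complex) \<Rightarrow> ((real^'n \<Rightarrow> complex) \<Rightarrow> complex) \<Rightarrow> 'n::finite phase \<Rightarrow> complex" where
  "stft \<phi> u z = u (rho z \<phi>)"


section \<open>The modulation spaces \<open>M\<^sup>1\<close> and \<open>M\<^sup>\<infinity>\<close>\<close>

text \<open>
  Every tempered distribution whose short-time Fourier transform is integrable is given by a
  unique continuous function. Elements of \<open>M1\<close> are these continuous representatives, since the
  Zak transform evaluates them pointwise.
\<close>

definition M1 :: "(real^'n \<Rightarrow> complex) \<Rightarrow> (real^'n \<Rightarrow> complex) set" where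
  "M1 \<phi> = {h. continuous_on UNIV h \<and>
             (\<forall>f\<in>schwartz. integrable lborel (\<lambda>t. h t * cnj (f t))) \<and>
             tempered_distribution (L2_inner h) \<and>
             integrable lborel (stft \<phi> (L2_inner h))}"

definition M1_norm :: "(real^'n \<Rightarrow> complex) \<Rightarrow> (real^'n \<Rightarrow> complex) \<Rightarrow> real" where
  "M1_norm \<phi> h = (LINT z|lborel. cmod (stft \<phi> (L2_inner h) z))"

text \<open>
  \<open>Minf\<close> is the dual of \<open>M1\<close>, realised by bounded conjugate-linear functionals; the
  pairing of \<open>F\<close> with \<open>h\<close> is \<open>F h\<close>. The value \<open>0\<close> outside \<open>M1\<close> makes equality of functionals
  on \<open>M1\<close> the same as equality in HOL.
\<close>

definition Minf :: "(real^'n \<Rightarrow> complex) \<Rightarrow> ((real^'n \<Rightarrow> complex) \<Rightarrow> complex) set" where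
  "Minf \<phi> = {F. (\<forall>h\<in>M1 \<phi>. \<forall>k\<in>M1 \<phi>. F (\<lambda>t. h t + k t) = F h + F k) \<and>
               (\<forall>a. \<forall>h\<in>M1 \<phi>. F (\<lambda>t. a * h t) = cnj a * F h) \<and>
               (\<exists>C. \<forall>h\<in>M1 \<phi>. cmod (F h) \<le> C * M1_norm \<phi> h) \<and>
               (\<forall>h. h \<notin> M1 \<phi> \<longrightarrow> F h = 0)}"

definition rho_dual ::
  "'n::finite phase \<Rightarrow> ((real^'n \<Rightarrow> complex) \<Rightarrow> complex) \<Rightarrow> (real^'n \<Rightarrow> complex) \<Rightarrow> complex" where
  "rho_dual z F = (\<lambda>h. F (rho (- z) h))"


section \<open>The lattice and its stabilised subspace\<close>

text \<open>The matrix \<open>D\<close> is given by its diagonal entries \<open>d :: 'n \<Rightarrow> nat\<close>.\<close>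

definition D_half :: "('n \<Rightarrow> nat) \<Rightarrow> int^'n \<Rightarrow> real^'n" where
  "D_half d k = (\<chi> j. sqrt (real (d j)) * of_int (k $ j))"

definition D_neg_half :: "('n \<Rightarrow> nat) \<Rightarrow> int^'n \<Rightarrow> real^'n" where
  "D_neg_half d k = (\<chi> j. of_int (k $ j) / sqrt (real (d j)))"

definition Lat :: "('n \<Rightarrow> nat) \<Rightarrow> 'n::finite phase set" where
  "Lat d = range (D_half d) \<times> range (D_half d)"

text \<open>On \<open>Lat d\<close> the quotients below are integers and \<open>floor\<close> only converts their type.\<close>

definition chi :: "('n::finite \<Rightarrow> nat) \<Rightarrow> 'n::finite phase \<Rightarrow> complex" where
  "chi d z = (- 1) powi (\<Sum>j\<in>UNIV. \<lfloor>fst z $ j / sqrt (real (d j))\<rfloor> * int (d j)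
                                  * \<lfloor>snd z $ j / sqrt (real (d j))\<rfloor>)"

definition code_space ::
  "(real^'n \<Rightarrow> complex) \<Rightarrow> ('n::finite \<Rightarrow> nat) \<Rightarrow> ((real^'n \<Rightarrow> complex) \<Rightarrow> complex) set" where
  "code_space \<phi> d =
     {\<psi> \<in> Minf \<phi>. \<forall>l\<in>Lat d. (\<lambda>h. chi d l * rho_dual l \<psi> h) = \<psi>}"


section \<open>Finite index groups and the Zak transform\<close>

text \<open>
  Residue classes are labelled by their least nonnegative representatives, and vectors indexed by
  a finite set of labels are functions vanishing off that set.
\<close>

definition Zd :: "('n \<Rightarrow> nat) \<Rightarrow> (int^'n) set" where
  "Zd d = {r. \<forall>j. 0 \<le> r $ j \<and> r $ j < int (d j)}"

definition KD :: "('n \<Rightarrow> nat) \<Rightarrow> ((int^'n) \<times> (int^'n)) set" where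
  "KD d = Zd d \<times> Zd d"

definition Hd :: "('n \<Rightarrow> nat) \<Rightarrow> (int^'n \<Rightarrow> complex) set" where
  "Hd d = {c. \<forall>r. r \<notin> Zd d \<longrightarrow> c r = 0}"

definition l2_inner :: "'i set \<Rightarrow> ('i \<Rightarrow> complex) \<Rightarrow> ('i \<Rightarrow> complex) \<Rightarrow> complex" where
  "l2_inner I u v = (\<Sum>i\<in>I. u i * cnj (v i))"

definition l2_norm :: "'i set \<Rightarrow> ('i \<Rightarrow> complex) \<Rightarrow> real" where
  "l2_norm I u = sqrt (\<Sum>i\<in>I. (cmod (u i))\<^sup>2)"

definition zak ::
  "('n \<Rightarrow> nat) \<Rightarrow> (real^'n \<Rightarrow> complex) \<Rightarrow> real^'n \<Rightarrow> real^'n \<Rightarrow> complex" where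
  "zak d h x \<omega> = (\<Sum>\<^sub>\<infinity>\<gamma>\<in>range (D_half d). h (x - \<gamma>) * cis (2 * pi * (\<gamma> \<bullet> \<omega>)))"

definition zak_vec ::
  "('n \<Rightarrow> nat) \<Rightarrow> (real^'n \<Rightarrow> complex) \<Rightarrow> real^'n \<Rightarrow> real^'n \<Rightarrow> int^'n \<Rightarrow> complex" where
  "zak_vec d h x \<omega> = (\<lambda>r. if r \<in> Zd d
     then cis (- (2 * pi * (D_neg_half d r \<bullet> \<omega>))) * zak d h (x + D_neg_half d r) \<omega> else 0)"

definition psi ::
  "(real^'n \<Rightarrow> complex) \<Rightarrow> ('n::finite \<Rightarrow> nat) \<Rightarrow> (int^'n \<Rightarrow> complex)
     \<Rightarrow> (real^'n \<Rightarrow> complex) \<Rightarrow> complex" where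
  "psi \<phi> d c = (THE \<psi>. \<psi> \<in> code_space \<phi> d \<and>
                   (\<forall>h\<in>M1 \<phi>. \<psi> h = l2_inner (Zd d) c (zak_vec d h 0 0)))"


section \<open>Multi-window Gabor frames and coefficient blocks\<close>

definition square_integrable :: "(real^'n \<Rightarrow> complex) \<Rightarrow> bool" where
  "square_integrable f \<longleftrightarrow>
     f \<in> borel_measurable lborel \<and> integrable lborel (\<lambda>t. (cmod (f t))\<^sup>2)"

definition gabor_frame :: "('n \<Rightarrow> nat) \<Rightarrow> ('m::finite \<Rightarrow> real^'n \<Rightarrow> complex) \<Rightarrow> bool" where
  "gabor_frame d g \<longleftrightarrow>
     (\<exists>A>0. \<exists>B>0. \<forall>f. square_integrable f \<longrightarrow>
        (\<lambda>(l, s). (cmod (L2_inner f (rho l (g s))))\<^sup>2) summable_on (Lat d \<times> UNIV) \<and>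
        A * (LINT t|lborel. (cmod (f t))\<^sup>2)
          \<le> (\<Sum>\<^sub>\<infinity>(l, s)\<in>Lat d \<times> UNIV. (cmod (L2_inner f (rho l (g s))))\<^sup>2) \<and>
        (\<Sum>\<^sub>\<infinity>(l, s)\<in>Lat d \<times> UNIV. (cmod (L2_inner f (rho l (g s))))\<^sup>2)
          \<le> B * (LINT t|lborel. (cmod (f t))\<^sup>2))"

definition window_comb ::
  "('m::finite \<Rightarrow> real^'n \<Rightarrow> complex) \<Rightarrow> complex^'m \<Rightarrow> real^'n \<Rightarrow> complex" where
  "window_comb g \<alpha> = (\<lambda>t. \<Sum>s\<in>UNIV. cnj (\<alpha> $ s) * g s t)"

definition v_vec ::
  "('n \<Rightarrow> nat) \<Rightarrow> ('m::finite \<Rightarrow> real^'n \<Rightarrow> complex) \<Rightarrow> complex^'m \<Rightarrow> int^'n \<Rightarrow> complex" where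
  "v_vec d g \<alpha> = (\<lambda>r. \<Sum>s\<in>UNIV. cnj (\<alpha> $ s) * zak_vec d (g s) 0 0 r)"

definition adj_coeff ::
  "('n::finite \<Rightarrow> nat) \<Rightarrow> ('m::finite \<Rightarrow> real^'n \<Rightarrow> complex) \<Rightarrow> complex^'m \<Rightarrow> 'n::finite phase
     \<Rightarrow> ((real^'n \<Rightarrow> complex) \<Rightarrow> complex) \<Rightarrow> complex" where
  "adj_coeff d g \<alpha> \<mu> F = 1 / of_nat (\<Prod>j\<in>UNIV. d j) * F (rho \<mu> (window_comb g \<alpha>))"

text \<open>
  A choice of integer representatives for the classes in \<open>KD\<close>; nothing forces it to be the
  choice of labels made above.
\<close>

definition representatives ::
  "('n \<Rightarrow> nat) \<Rightarrow> ((int^'n) \<times> (int^'n) \<Rightarrow> (int^'n) \<times> (int^'n)) \<Rightarrow> bool" where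
  "representatives d rep \<longleftrightarrow>
     (\<forall>q\<in>KD d. \<forall>j. fst (rep q) $ j mod int (d j) = fst q $ j \<and>
                   snd (rep q) $ j mod int (d j) = snd q $ j)"

definition nu ::
  "('n \<Rightarrow> nat) \<Rightarrow> ((int^'n) \<times> (int^'n) \<Rightarrow> (int^'n) \<times> (int^'n))
     \<Rightarrow> (int^'n) \<times> (int^'n) \<Rightarrow> 'n::finite phase" where
  "nu d rep q = (D_neg_half d (fst (rep q)), D_neg_half d (snd (rep q)))"

definition block ::
  "('n::finite \<Rightarrow> nat) \<Rightarrow> ((int^'n) \<times> (int^'n) \<Rightarrow> (int^'n) \<times> (int^'n))
     \<Rightarrow> ('m::finite \<Rightarrow> real^'n \<Rightarrow> complex) \<Rightarrow> complex^'m \<Rightarrow> 'n::finite phase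
     \<Rightarrow> ((real^'n \<Rightarrow> complex) \<Rightarrow> complex) \<Rightarrow> 'n::finite phase \<Rightarrow> (int^'n) \<times> (int^'n) \<Rightarrow> complex" where
  "block d rep g \<alpha> \<zeta> f l = (\<lambda>q. if q \<in> KD d
     then of_real (sqrt (real (\<Prod>j\<in>UNIV. d j)) / l2_norm (Zd d) (v_vec d g \<alpha>))
          * (cis (pi * sympl l (nu d rep q)) * adj_coeff d g \<alpha> (l + nu d rep q) (rho_dual \<zeta> f))
     else 0)"

end

theory Submission
  imports Defs "HOL-Probability.Characteristic_Functions" "HOL-Real_Asymp.Real_Asymp"
begin

text \<open>
  The covariance of the blocks is pure commutation: moving \<open>\<rho>(\<lambda>)\<close> past \<open>\<rho>(-\<zeta>)\<close> and
  \<open>\<rho>(\<nu>\<^sub>q)\<close> costs phases, and \<open>f\<close> absorbs \<open>\<rho>(\<lambda>)\<close> up to the sign \<open>\<chi>\<^sub>D(\<lambda>)\<close>.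

  The statement on \<open>\<psi>\<^sub>c\<close> rests on \<open>\<Sum>\<^sub>\<gamma> sup\<^bsub>\<bar>s\<bar><r\<^esub> \<bar>h(x - \<gamma> + s)\<bar> \<le> C \<parallel>h\<parallel>\<close> for \<open>h\<close> in \<open>M\<^sup>1\<close>, which
  makes \<open>\<psi>\<^sub>c\<close> well defined and continuous along \<open>\<zeta> \<mapsto> \<rho>(-\<zeta>)h\<close>. To get it, view the short-time Fourier
  transform at a fixed position \<open>x\<close> as the Fourier transform of \<open>h \<cdot> cnj (\<phi>(\<cdot> - x))\<close>; by inversion
  \<open>\<bar>h(t) \<phi>(t - x)\<bar>\<close> is at most its \<open>L\<^sup>1\<close> norm \<open>G(x)\<close> in the frequency variable, for all \<open>t\<close> and almost
  all \<open>x\<close>. Averaging over those \<open>x\<close> for which \<open>t - x\<close> lies in a ball where \<open>\<phi>\<close> is bounded below gives the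
  estimate, the balls belonging to different lattice points being disjoint.

  For \<open>\<zeta> = 0\<close> the entries of the block are, up to phases, the Fourier coefficients over \<open>\<int>\<^sub>d\<close> of
  \<open>p \<mapsto> c\<^sub>p cnj (v(p - r))\<close>. If all of them vanish, then \<open>c\<^sub>p cnj (v(p - r)) = 0\<close> for all \<open>p\<close> and \<open>r\<close>,
  so \<open>c = 0\<close> or \<open>v = 0\<close>.
\<close>


section \<open>A bound from Fourier inversion\<close>

text \<open>Lebesgue measure is the image of the product of one-dimensional Lebesgue measures under
  the coordinate map, so Fubini splits a product of functions of single coordinates.\<close>

lemma lborel_prod_factor:
  fixes f :: "'a::euclidean_space \<Rightarrow> real \<Rightarrow> complex"
  assumes "\<And>b. b \<in> Basis \<Longrightarrow> integrable lborel (f b)"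
  shows "integrable lborel (\<lambda>x. \<Prod>b\<in>Basis. f b (x \<bullet> b))"
    and "(LINT x|lborel. (\<Prod>b\<in>Basis. f b (x \<bullet> b))) = (\<Prod>b\<in>Basis. (LINT x|lborel. f b x))"
proof -
  interpret product_sigma_finite "\<lambda>b::'a. lborel :: real measure"
    by (simp add: product_sigma_finite_def sigma_finite_lborel)
  let ?M = "\<Pi>\<^sub>M b\<in>Basis. (lborel :: real measure)"
  let ?T = "\<lambda>x. \<Sum>b\<in>Basis. x b *\<^sub>R (b::'a)"
  have T: "?T \<in> measurable ?M borel"
    by measurable
  have [measurable]: "b \<in> Basis \<Longrightarrow> f b \<in> borel_measurable borel" for b
    using borel_measurable_integrable[OF assms] by simp
  have F: "(\<lambda>x::'a. \<Prod>b\<in>Basis. f b (x \<bullet> b)) \<in> borel_measurable borel"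
    by measurable
  have coord: "(\<Prod>b\<in>Basis. f b (?T x \<bullet> b)) = (\<Prod>b\<in>Basis. f b (x b))" for x
    by (rule prod.cong) auto
  show "integrable lborel (\<lambda>x. \<Prod>b\<in>Basis. f b (x \<bullet> b))"
    by (subst lborel_eq, subst integrable_distr_eq[OF T F], unfold coord)
       (rule product_integrable_prod, auto intro: assms)
  show "(LINT x|lborel. (\<Prod>b\<in>Basis. f b (x \<bullet> b))) = (\<Prod>b\<in>Basis. (LINT x|lborel. f b x))"
    by (subst lborel_eq, subst integral_distr[OF T F], unfold coord)
       (rule product_integral_prod, auto intro: assms)
qed

text \<open>For \<open>a = 1\<close> this is the characteristic function of the standard normal
  distribution; the general case follows by the substitution \<open>a * x\<close>.\<close>

lemma gaussian_real:
  fixes a t :: real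
  assumes "a > 0"
  shows "integrable lborel (\<lambda>x. of_real (exp (- (a * x)\<^sup>2 / 2)) * cis (t * x))"
    and "(LINT x|lborel. of_real (exp (- (a * x)\<^sup>2 / 2)) * cis (t * x))
           = of_real (sqrt (2 * pi) / a * exp (- (t / a)\<^sup>2 / 2))"
proof -
  let ?g = "\<lambda>s x. complex_of_real (exp (- x\<^sup>2 / 2)) * cis (s * x)"
  have int: "integrable lborel (?g s)" for s
  proof (rule Bochner_Integration.integrable_bound)
    show "integrable lborel (\<lambda>x. sqrt (2 * pi) * std_normal_density x)"
      using integrable_std_normal_moment[of 0] by simp
    show "?g s \<in> borel_measurable lborel"
      by (intro borel_measurable_times) (auto intro!: borel_measurable_continuous_onI continuous_intros)
  qed (auto simp: norm_mult std_normal_density_def)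
  have ch: "complex_of_real (exp (- s\<^sup>2 / 2)) = of_real (1 / sqrt (2 * pi)) * (LINT x|lborel. ?g s x)" for s
  proof -
    have "complex_of_real (exp (- s\<^sup>2 / 2)) = char std_normal_distribution s"
      by (simp add: char_std_normal_distribution)
    also have "\<dots> = (LINT x|lborel. std_normal_density x *\<^sub>R iexp (s * x))"
      unfolding char_def by (subst integral_density) (auto intro!: AE_I2)
    also have "\<dots> = (LINT x|lborel. of_real (1 / sqrt (2 * pi)) * ?g s x)"
      by (rule Bochner_Integration.integral_cong)
         (auto simp: std_normal_density_def scaleR_conv_of_real cis_conv_exp)
    finally show ?thesis by simp
  qed
  have val: "(LINT x|lborel. ?g s x) = of_real (sqrt (2 * pi) * exp (- s\<^sup>2 / 2))" for s
    using ch[of s] by (simp add: field_simps)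
  have eq: "?g (t / a) (0 + a * x) = of_real (exp (- (a * x)\<^sup>2 / 2)) * cis (t * x)" for x
    using assms by simp
  show "integrable lborel (\<lambda>x. of_real (exp (- (a * x)\<^sup>2 / 2)) * cis (t * x))"
    using lborel_integrable_real_affine[OF int[of "t/a"], of a 0] assms unfolding eq by simp
  have "(LINT x|lborel. ?g (t / a) x) = a *\<^sub>R (LINT x|lborel. of_real (exp (- (a * x)\<^sup>2 / 2)) * cis (t * x))"
    using lborel_integral_real_affine[of a "?g (t / a)" 0] assms unfolding eq by simp
  then show "(LINT x|lborel. of_real (exp (- (a * x)\<^sup>2 / 2)) * cis (t * x))
           = of_real (sqrt (2 * pi) / a * exp (- (t / a)\<^sup>2 / 2))"
    unfolding val using assms by (simp add: scaleR_conv_of_real field_simps)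
qed

lemma cis_sum: "finite A \<Longrightarrow> cis (sum f A) = (\<Prod>b\<in>A. cis (f b))"
  by (induction rule: finite_induct) (auto simp: cis_mult[symmetric])

text \<open>Both the Gaussian and the character \<open>cis (y \<bullet> x)\<close> factor over the
  basis, which reduces everything to one real variable.\<close>

lemma gaussian_transform:
  fixes y :: "'a::euclidean_space"
  assumes "a > 0"
  shows "integrable lborel (\<lambda>x::'a. of_real (exp (- (a * norm x)\<^sup>2 / 2)) * cis (y \<bullet> x))"
    and "(LINT x|lborel. of_real (exp (- (a * norm x)\<^sup>2 / 2)) * cis (y \<bullet> x))
           = of_real ((sqrt (2 * pi) / a) ^ DIM('a) * exp (- (norm y / a)\<^sup>2 / 2))"
proof -
  have nrm: "(norm v)\<^sup>2 = (\<Sum>b\<in>Basis. (v \<bullet> b)\<^sup>2)" for v :: 'a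
    by (subst euclidean_inner[of v v, folded power2_norm_eq_inner]) (simp add: power2_eq_square)
  have split: "exp (- (c * norm v)\<^sup>2 / 2) = (\<Prod>b\<in>Basis. exp (- (c * (v \<bullet> b))\<^sup>2 / 2))" for c and v :: 'a
    by (simp add: exp_sum[symmetric] power_mult_distrib nrm sum_distrib_left sum_negf sum_divide_distrib)
  have inn: "y \<bullet> x = (\<Sum>b\<in>Basis. (y \<bullet> b) * (x \<bullet> b))" for x
    by (rule euclidean_inner)
  have eq: "of_real (exp (- (a * norm x)\<^sup>2 / 2)) * cis (y \<bullet> x)
      = (\<Prod>b\<in>Basis. of_real (exp (- (a * (x \<bullet> b))\<^sup>2 / 2)) * cis ((y \<bullet> b) * (x \<bullet> b)))" for x
    by (subst inn, subst split) (simp add: cis_sum prod.distrib)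
  show "integrable lborel (\<lambda>x::'a. of_real (exp (- (a * norm x)\<^sup>2 / 2)) * cis (y \<bullet> x))"
    unfolding eq by (rule lborel_prod_factor) (rule gaussian_real[OF assms])
  have "(LINT x|lborel. of_real (exp (- (a * norm x)\<^sup>2 / 2)) * cis (y \<bullet> x))
      = (\<Prod>b\<in>(Basis::'a set). of_real (sqrt (2 * pi) / a * exp (- ((y \<bullet> b) / a)\<^sup>2 / 2)))"
    unfolding eq by (subst lborel_prod_factor) (auto simp only: gaussian_real[OF assms])
  also have "\<dots> = of_real ((sqrt (2 * pi) / a) ^ DIM('a) * exp (- (norm y / a)\<^sup>2 / 2))"
    using split[of "1 / a" y] by (simp add: prod.distrib prod_dividef power_divide)
  finally show "(LINT x|lborel. of_real (exp (- (a * norm x)\<^sup>2 / 2)) * cis (y \<bullet> x))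
           = of_real ((sqrt (2 * pi) / a) ^ DIM('a) * exp (- (norm y / a)\<^sup>2 / 2))" .
qed

section \<open>Gaussian regularization of Fourier inversion\<close>

lemma lborel_integral_shift:
  fixes f :: "'a::euclidean_space \<Rightarrow> 'b::{banach, second_countable_topology}"
  assumes "f \<in> borel_measurable borel"
  shows "(LINT x|lborel. f (c + x)) = (LINT x|lborel. f x)"
    and "integrable lborel (\<lambda>x. f (c + x)) \<longleftrightarrow> integrable lborel f"
  using integral_distr[of "(+) c" lborel borel f] integrable_distr_eq[of "(+) c" lborel borel f] assms
  by (simp_all add: lborel_distr_plus)

text \<open>The Fourier transform of the damping factor
  \<open>exp (- (a * norm \<omega>)\<^sup>2 / 2)\<close>, taken at \<open>2 * pi * y\<close>. It
  concentrates at the origin as \<open>a\<close> tends to 0.\<close>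

definition gauss_kernel :: "real \<Rightarrow> 'a::euclidean_space \<Rightarrow> real" where
  "gauss_kernel a y = (sqrt (2 * pi) / a) ^ DIM('a) * exp (- (2 * pi * norm y / a)\<^sup>2 / 2)"

lemma gauss_kernel_integral:
  fixes t :: "'a::euclidean_space"
  assumes "a > 0"
  shows "integrable lborel (\<lambda>s. gauss_kernel a (t - s))"
    and "(LINT s|lborel. gauss_kernel a (t - s)) = 1"
proof -
  \<comment> \<open>With this \<open>b\<close> the kernel is a multiple of a Gaussian of parameter
    \<open>b\<close>, so its mass is the Gaussian transform at frequency 0.\<close>
  define b where "b = 2 * pi / a"
  have b: "b > 0"
    using assms by (simp add: b_def)
  have K: "gauss_kernel a y = (sqrt (2 * pi) / a) ^ DIM('a) * exp (- (b * norm y)\<^sup>2 / 2)" for y :: 'a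
    using assms by (simp add: gauss_kernel_def b_def)
  let ?E = "\<lambda>x::'a. exp (- (b * norm x)\<^sup>2 / 2)"
  have "integrable lborel (\<lambda>x. Re (complex_of_real (?E x)))"
    using gaussian_transform(1)[OF b, of "0::'a"] by (intro integrable_Re) simp
  then have E: "integrable lborel ?E" by simp
  have "complex_of_real (LINT x|lborel. ?E x) = of_real ((sqrt (2 * pi) / b) ^ DIM('a))"
    using gaussian_transform(2)[OF b, of "0::'a"] by simp
  then have V: "(LINT x|lborel. ?E x) = (sqrt (2 * pi) / b) ^ DIM('a)"
    by (simp only: of_real_eq_iff)
  have m: "?E \<in> borel_measurable borel"
    by (auto intro!: borel_measurable_continuous_onI continuous_intros)
  have eq: "gauss_kernel a (t - s) = (sqrt (2 * pi) / a) ^ DIM('a) * ?E (- t + s)" for s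
    unfolding K by (simp add: norm_minus_commute)
  show "integrable lborel (\<lambda>s. gauss_kernel a (t - s))"
    unfolding eq using lborel_integral_shift(2)[OF m, of "- t"] E by simp
  have "(LINT s|lborel. gauss_kernel a (t - s)) = (sqrt (2 * pi) / a) ^ DIM('a) * (sqrt (2 * pi) / b) ^ DIM('a)"
    unfolding eq using lborel_integral_shift(1)[OF m, of "- t"] V by simp
  also have "\<dots> = ((sqrt (2 * pi) / a) * (sqrt (2 * pi) / b)) ^ DIM('a)"
    by (simp only: power_mult_distrib)
  also have "(sqrt (2 * pi) / a) * (sqrt (2 * pi) / b) = 1"
    using assms by (simp add: b_def)
  finally show "(LINT s|lborel. gauss_kernel a (t - s)) = 1" by simp
qed

text \<open>The damping makes the double integral absolutely convergent. After exchanging the order,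
  the integral over \<open>\<omega>\<close> is the Gaussian transform at
  \<open>2 * pi * (t - s)\<close>.\<close>

lemma gauss_regularized_inversion:
  fixes u :: "'a::euclidean_space \<Rightarrow> complex"
  assumes "integrable lborel u" "a > 0"
  shows "(LINT \<omega>|lborel. (LINT s|lborel. u s * cis (- (2 * pi * (\<omega> \<bullet> s)))) *
            (of_real (exp (- (a * norm \<omega>)\<^sup>2 / 2)) * cis (2 * pi * (\<omega> \<bullet> t))))
       = (LINT s|lborel. u s * of_real (gauss_kernel a (t - s)))"
proof -
  let ?E = "\<lambda>\<omega>::'a. complex_of_real (exp (- (a * norm \<omega>)\<^sup>2 / 2))"
  let ?f = "\<lambda>s \<omega>. u s * (?E \<omega> * cis (((2 * pi) *\<^sub>R (t - s)) \<bullet> \<omega>))"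
  have [measurable]: "u \<in> borel_measurable borel"
    using borel_measurable_integrable[OF assms(1)] by simp
  have meas: "case_prod ?f \<in> borel_measurable (lborel \<Otimes>\<^sub>M lborel)"
  proof -
    have 1: "(\<lambda>p::'a\<times>'a. u (fst p)) \<in> borel_measurable (lborel \<Otimes>\<^sub>M lborel)"
      by measurable
    have 2: "(\<lambda>p::'a\<times>'a. ?E (snd p) * cis (((2 * pi) *\<^sub>R (t - fst p)) \<bullet> snd p)) \<in> borel_measurable (lborel \<Otimes>\<^sub>M lborel)"
      unfolding lborel_prod measurable_lborel2
      by (auto intro!: borel_measurable_continuous_onI continuous_intros)
    show ?thesis
      using borel_measurable_times[OF 1 2] by (simp add: case_prod_beta')
  qed
  have G: "integrable lborel (\<lambda>\<omega>. ?E \<omega> * cis (y \<bullet> \<omega>))" for y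
    by (rule gaussian_transform(1)[OF assms(2)])
  have int: "integrable (lborel \<Otimes>\<^sub>M lborel) (case_prod ?f)"
  proof (rule lborel_pair.Fubini_integrable[OF meas])
    have "(LINT \<omega>|lborel. norm (case (s, \<omega>) of (x, y) \<Rightarrow> ?f x y)) = cmod (u s) * (LINT \<omega>|lborel. cmod (?E \<omega>))" for s
      by (simp add: norm_mult)
    then show "integrable lborel (\<lambda>s. LINT \<omega>|lborel. norm (case (s, \<omega>) of (x, y) \<Rightarrow> ?f x y))"
      using assms(1) by simp
    show "AE s in lborel. integrable lborel (\<lambda>\<omega>. case (s, \<omega>) of (x, y) \<Rightarrow> ?f x y)"
      by (rule AE_I2, unfold case_prod_conv, rule Bochner_Integration.integrable_mult_right[OF G])
  qed
  have eq: "(LINT s|lborel. u s * cis (- (2 * pi * (\<omega> \<bullet> s)))) * (?E \<omega> * cis (2 * pi * (\<omega> \<bullet> t)))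
         = (LINT s|lborel. ?f s \<omega>)" for \<omega>
  proof -
    have "?f s \<omega> = u s * cis (- (2 * pi * (\<omega> \<bullet> s))) * (?E \<omega> * cis (2 * pi * (\<omega> \<bullet> t)))" for s
    proof -
      have "((2 * pi) *\<^sub>R (t - s)) \<bullet> \<omega> = - (2 * pi * (\<omega> \<bullet> s)) + 2 * pi * (\<omega> \<bullet> t)"
        by (simp add: inner_diff_right inner_commute algebra_simps)
      then show ?thesis by (simp only: cis_mult[symmetric]) (simp add: ac_simps)
    qed
    then show ?thesis by (simp only: integral_mult_left_zero)
  qed
  have "(LINT \<omega>|lborel. LINT s|lborel. ?f s \<omega>) = (LINT s|lborel. LINT \<omega>|lborel. ?f s \<omega>)"
    by (rule lborel_pair.Fubini_integral[OF int])
  also have "\<dots> = (LINT s|lborel. u s * of_real (gauss_kernel a (t - s)))"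
    unfolding integral_mult_right_zero gaussian_transform(2)[OF assms(2)] gauss_kernel_def norm_scaleR
    by simp
  finally show ?thesis unfolding eq .
qed

text \<open>The damped inversion integral is at most the L^1 norm of the transform, whatever the
  damping. It equals a convolution of \<open>u\<close> with a kernel of mass 1, which tends to
  \<open>u t\<close> as the damping parameter \<open>a\<close> tends to 0.\<close>

lemma fourier_inversion_bound:
  fixes u :: "'a::euclidean_space \<Rightarrow> complex"
  assumes cont: "continuous_on UNIV u" and int: "integrable lborel u"
    and hat: "integrable lborel (\<lambda>\<omega>. LINT s|lborel. u s * cis (- (2 * pi * (\<omega> \<bullet> s))))"
  shows "cmod (u t) \<le> (LINT \<omega>|lborel. cmod (LINT s|lborel. u s * cis (- (2 * pi * (\<omega> \<bullet> s)))))"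
    (is "_ \<le> ?M")
proof (rule field_le_epsilon)
  let ?U = "\<lambda>\<omega>. LINT s|lborel. u s * cis (- (2 * pi * (\<omega> \<bullet> s)))"
  fix e :: real assume "e > 0"
  have "isCont u t" using cont by (simp add: continuous_on_eq_continuous_at)
  with \<open>e > 0\<close> obtain \<delta> where \<delta>: "\<delta> > 0" "\<And>s. dist s t < \<delta> \<Longrightarrow> dist (u s) (u t) < e"
    unfolding continuous_at_eps_delta by blast
  define N where "N = DIM('a)"
  \<comment> \<open>Controls for distances at least \<open>\<delta>\<close> from \<open>t\<close>.
    Giving up half of the exponent bounds the kernel by \<open>q1 a\<close> times the wider kernel
    of parameter \<open>sqrt 2 * a\<close>, which still has mass 1; \<open>q2 a\<close> bounds the
    kernel pointwise. The first is paired with the constant \<open>u t\<close>, the second with the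
    integrable \<open>u s\<close>.\<close>
  define q1 where "q1 = (\<lambda>a. sqrt 2 ^ N * exp (- (pi * \<delta> / a)\<^sup>2))"
  define q2 where "q2 = (\<lambda>a. (sqrt (2 * pi) / a) ^ N * exp (- (2 * pi * \<delta> / a)\<^sup>2 / 2))"
  define L where "L = (LINT s|lborel. cmod (u s))"
  have main: "cmod (u t) \<le> ?M + e + cmod (u t) * q1 a + L * q2 a" if a: "a > 0" for a
  proof -
    let ?K = "\<lambda>s. gauss_kernel a (t - s)" and ?K' = "\<lambda>s. gauss_kernel (sqrt 2 * a) (t - s)"
    let ?E = "\<lambda>\<omega>. complex_of_real (exp (- (a * norm \<omega>)\<^sup>2 / 2)) * cis (2 * pi * (\<omega> \<bullet> t))"
    have a': "sqrt 2 * a > 0" using a by simp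
    have K0: "?K s \<ge> 0" "?K' s \<ge> 0" for s
      using a by (auto simp: gauss_kernel_def)
    have Kb: "?K s \<le> (sqrt (2 * pi) / a) ^ N" for s
      unfolding gauss_kernel_def N_def using a by (intro mult_left_le) auto
    have uK: "integrable lborel (\<lambda>s. u s * of_real (?K s))"
    proof (rule Bochner_Integration.integrable_bound)
      show "integrable lborel (\<lambda>s. (sqrt (2 * pi) / a) ^ N * cmod (u s))"
        using int by simp
      show "(\<lambda>s. u s * of_real (?K s)) \<in> borel_measurable lborel"
        using borel_measurable_integrable[OF int] borel_measurable_integrable[OF gauss_kernel_integral(1)[OF a, of t]]
        by simp
      show "AE s in lborel. norm (u s * complex_of_real (?K s)) \<le> norm ((sqrt (2 * pi) / a) ^ N * cmod (u s))"
        using Kb K0 a by (intro AE_I2) (auto simp: norm_mult mult.commute intro!: mult_left_mono)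
    qed
    have cK: "integrable lborel (\<lambda>s. u t * of_real (?K s))"
      using gauss_kernel_integral(1)[OF a, of t] by simp
    have c: "(LINT s|lborel. u t * of_real (?K s)) = u t"
      using gauss_kernel_integral(2)[OF a, of t] by simp
    \<comment> \<open>Since the kernel has mass 1, \<open>u t\<close> is the convolution plus an
      averaged difference; the two parts are estimated separately.\<close>
    have "u t = (LINT s|lborel. u s * of_real (?K s)) + (LINT s|lborel. u t * of_real (?K s) - u s * of_real (?K s))"
      unfolding Bochner_Integration.integral_diff[OF cK uK] c by simp
    then have "cmod (u t) \<le> cmod (LINT s|lborel. u s * of_real (?K s))
        + cmod (LINT s|lborel. u t * of_real (?K s) - u s * of_real (?K s))"
      by (rule ord_eq_le_trans[OF arg_cong[where f = cmod] norm_triangle_ineq])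
    \<comment> \<open>The convolution is the damped inversion integral, and damping factor times
      character has modulus at most 1.\<close>
    moreover have "cmod (LINT s|lborel. u s * of_real (?K s)) \<le> ?M"
      unfolding gauss_regularized_inversion[OF int a, symmetric]
    proof (rule order_trans[OF integral_norm_bound], rule integral_mono_AE)
      have E: "cmod (?E \<omega>) \<le> 1" for \<omega>
        by (simp add: norm_mult)
      have ptw: "norm (?U \<omega> * ?E \<omega>) \<le> cmod (?U \<omega>)" for \<omega>
        using E[of \<omega>] by (subst norm_mult) (intro mult_left_le, auto)
      show "integrable lborel (\<lambda>\<omega>. cmod (?U \<omega>))" using hat by simp
      show "integrable lborel (\<lambda>\<omega>. norm (?U \<omega> * ?E \<omega>))"
      proof (rule Bochner_Integration.integrable_bound)
        show "integrable lborel (\<lambda>\<omega>. cmod (?U \<omega>))" using hat by simp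
        have "?E \<in> borel_measurable lborel"
          by (auto intro!: borel_measurable_continuous_onI continuous_intros)
        from measurable_compose[OF borel_measurable_times[OF borel_measurable_integrable[OF hat] this] borel_measurable_norm]
        show "(\<lambda>\<omega>. norm (?U \<omega> * ?E \<omega>)) \<in> borel_measurable lborel" .
      qed (use ptw in auto)
      show "AE \<omega> in lborel. norm (?U \<omega> * ?E \<omega>) \<le> cmod (?U \<omega>)"
        using ptw by simp
    qed
    moreover have "cmod (LINT s|lborel. u t * of_real (?K s) - u s * of_real (?K s)) \<le> e + cmod (u t) * q1 a + L * q2 a"
    proof -
      have ptw: "norm (u t * of_real (?K s) - u s * of_real (?K s))
                   \<le> e * ?K s + cmod (u t) * q1 a * ?K' s + cmod (u s) * q2 a" for s
      proof -
        have n: "norm (u t * of_real (?K s) - u s * of_real (?K s)) = dist (u s) (u t) * ?K s"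
          using K0 by (simp add: left_diff_distrib[symmetric] norm_mult dist_norm norm_minus_commute)
        show ?thesis
        proof (cases "dist s t < \<delta>")
          case True
          have "dist (u s) (u t) * ?K s \<le> e * ?K s"
            using \<delta>(2)[OF True] K0 by (intro mult_right_mono) auto
          moreover have "0 \<le> cmod (u t) * q1 a * ?K' s" "0 \<le> cmod (u s) * q2 a"
            using K0 a by (auto simp: q1_def q2_def)
          ultimately show ?thesis unfolding n by linarith
        next
          case False
          then have far: "\<delta> \<le> norm (t - s)" by (simp add: dist_norm norm_minus_commute)
          have sq: "(k * \<delta> / a)\<^sup>2 \<le> (k * norm (t - s) / a)\<^sup>2" if "k > 0" for k
            using far \<delta>(1) a that by (intro power_mono divide_right_mono mult_left_mono) auto
          have "?K s = sqrt 2 ^ N * exp (- (pi * norm (t - s) / a)\<^sup>2) * ?K' s"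
            using a by (simp add: gauss_kernel_def N_def power_mult_distrib power_divide exp_add[symmetric] field_simps)
          also have "\<dots> \<le> q1 a * ?K' s"
            unfolding q1_def using sq[of pi] K0 by (intro mult_right_mono mult_left_mono) auto
          finally have 1: "?K s \<le> q1 a * ?K' s" .
          have 2: "?K s \<le> q2 a"
            unfolding q2_def gauss_kernel_def N_def using sq[of "2*pi"] a by (intro mult_left_mono) auto
          have "dist (u s) (u t) * ?K s \<le> (cmod (u t) + cmod (u s)) * ?K s"
            using K0 norm_triangle_ineq4[of "u s" "u t"] by (intro mult_right_mono) (auto simp: dist_norm)
          also have "\<dots> \<le> cmod (u t) * (q1 a * ?K' s) + cmod (u s) * q2 a"
            using 1 2 by (auto simp: distrib_right intro!: add_mono mult_left_mono)
          also have "\<dots> \<le> e * ?K s + cmod (u t) * q1 a * ?K' s + cmod (u s) * q2 a"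
            using \<open>e > 0\<close> K0[of s] by simp
          finally show ?thesis unfolding n .
        qed
      qed
      have i3: "integrable lborel (\<lambda>s. e * ?K s + cmod (u t) * q1 a * ?K' s + cmod (u s) * q2 a)"
        using gauss_kernel_integral(1)[OF a, of t] gauss_kernel_integral(1)[OF a', of t] int by simp
      have "cmod (LINT s|lborel. u t * of_real (?K s) - u s * of_real (?K s))
          \<le> (LINT s|lborel. norm (u t * of_real (?K s) - u s * of_real (?K s)))"
        by (rule integral_norm_bound)
      also have "\<dots> \<le> (LINT s|lborel. e * ?K s + cmod (u t) * q1 a * ?K' s + cmod (u s) * q2 a)"
        using uK cK by (intro integral_mono i3 ptw) auto
      also have "\<dots> = e + cmod (u t) * q1 a + L * q2 a"
        using gauss_kernel_integral[OF a, of t] gauss_kernel_integral[OF a', of t] int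
        by (simp add: L_def)
      finally show ?thesis .
    qed
    ultimately show ?thesis by linarith
  qed
  have lim: "((\<lambda>x::real. c * (x ^ N * exp (- k * x\<^sup>2))) \<longlongrightarrow> 0) at_top" if "k > 0" for c k N
    using that by real_asymp
  \<comment> \<open>Putting \<open>a = 1 / x\<close> turns the limit at 0 into one at infinity,
    where Gaussian decay in \<open>x\<close> beats the power of \<open>x\<close>.\<close>
  have "((\<lambda>x. ?M + e + cmod (u t) * q1 (1 / x) + L * q2 (1 / x)) \<longlongrightarrow> ?M + e + cmod (u t) * 0 + L * 0) at_top"
  proof (intro tendsto_intros)
    have "q1 (1 / x) = sqrt 2 ^ N * (x ^ 0 * exp (- (pi * \<delta>)\<^sup>2 * x\<^sup>2))" for x
      by (simp add: q1_def power_mult_distrib)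
    then show "((\<lambda>x. q1 (1 / x)) \<longlongrightarrow> 0) at_top"
      using lim[of "(pi * \<delta>)\<^sup>2" "sqrt 2 ^ N" 0] \<delta>(1) by simp
    have "q2 (1 / x) = sqrt (2 * pi) ^ N * (x ^ N * exp (- ((2 * pi * \<delta>)\<^sup>2 / 2) * x\<^sup>2))" for x
      by (simp add: q2_def power_mult_distrib)
    then show "((\<lambda>x. q2 (1 / x)) \<longlongrightarrow> 0) at_top"
      using lim[of "(2 * pi * \<delta>)\<^sup>2 / 2" "sqrt (2 * pi) ^ N" N] \<delta>(1) by simp
  qed
  then have "cmod (u t) \<le> ?M + e + cmod (u t) * 0 + L * 0"
    by (rule tendsto_lowerbound) (auto intro!: eventually_at_top_linorderI[of 1] main)
  then show "cmod (u t) \<le> ?M + e" by simp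
qed


section \<open>Translation and time-frequency shifts\<close>

text \<open>The chain rule in both directions shows that exactly the same maps are derivatives, so
  the choice operator behind \<open>frechet_derivative\<close> selects the same one, differentiable
  or not.\<close>

lemma frechet_derivative_translate:
  "frechet_derivative (translate x f) (at y) = frechet_derivative f (at (y - x))"
proof -
  have "(translate x f has_derivative f') (at y) \<longleftrightarrow> (f has_derivative f') (at (y - x))" for f'
  proof
    assume "(f has_derivative f') (at (y - x))"
    then have "(f \<circ> (\<lambda>t. t - x) has_derivative f' \<circ> (\<lambda>t. t)) (at y)"
      by (intro diff_chain_at) (auto intro!: derivative_eq_intros)
    then show "(translate x f has_derivative f') (at y)"
      by (simp add: translate_def o_def)
  next
    assume "(translate x f has_derivative f') (at y)"
    then have "(translate x f \<circ> (\<lambda>t. t + x) has_derivative f' \<circ> (\<lambda>t. t)) (at (y - x))"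
      by (intro diff_chain_at) (auto intro!: derivative_eq_intros)
    then show "(f has_derivative f') (at (y - x))"
      by (simp add: translate_def o_def)
  qed
  then show ?thesis by (simp add: frechet_derivative_def)
qed

lemma differentiable_translate:
  assumes "f differentiable (at (y - x))"
  shows "translate x f differentiable (at y)"
proof -
  from assms obtain f' where "(f has_derivative f') (at (y - x))"
    by (auto simp: differentiable_def)
  then have "(f \<circ> (\<lambda>t. t - x) has_derivative f' \<circ> (\<lambda>t. t)) (at y)"
    by (intro diff_chain_at) (auto intro!: derivative_eq_intros)
  then show ?thesis
    by (auto simp: translate_def o_def differentiable_def)
qed

lemma iter_partial_translate: "iter_partial js (translate x f) = translate x (iter_partial js f)"
proof (induction js)
  case (Cons j js)
  then show ?case
    by (simp add: frechet_derivative_translate) (simp add: translate_def)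
qed simp

text \<open>Decay in \<open>y\<close> follows from decay in \<open>y - x\<close> and boundedness,
  because \<open>norm y ^ k\<close> is at most
  \<open>2 ^ k * (norm (y - x) ^ k + norm x ^ k)\<close>.\<close>

lemma schwartz_translate:
  assumes "f \<in> schwartz"
  shows "translate x f \<in> schwartz"
proof -
  have "\<exists>C. \<forall>y. norm y ^ k * cmod (iter_partial js (translate x f) y) \<le> C" for js k
  proof -
    let ?F = "iter_partial js f"
    obtain C D where C: "\<And>y. norm y ^ k * cmod (?F y) \<le> C" and D: "\<And>y. norm y ^ 0 * cmod (?F y) \<le> D"
      using assms unfolding schwartz_def by blast
    have "norm y ^ k * cmod (?F (y - x)) \<le> 2 ^ k * (C + norm x ^ k * D)" for y
    proof -
      have "norm y \<le> norm (y - x) + norm x"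
        by (metis diff_add_cancel norm_triangle_ineq)
      also have "\<dots> \<le> 2 * max (norm (y - x)) (norm x)" by simp
      finally have "norm y ^ k \<le> (2 * max (norm (y - x)) (norm x)) ^ k"
        by (intro power_mono) auto
      also have "\<dots> \<le> 2 ^ k * (norm (y - x) ^ k + norm x ^ k)"
        by (simp add: power_mult_distrib max_def)
      finally have "norm y ^ k * cmod (?F (y - x)) \<le> 2 ^ k * (norm (y - x) ^ k + norm x ^ k) * cmod (?F (y - x))"
        by (intro mult_right_mono) auto
      also have "\<dots> = 2 ^ k * (norm (y - x) ^ k * cmod (?F (y - x)) + norm x ^ k * (norm (y - x) ^ 0 * cmod (?F (y - x))))"
        by (simp add: algebra_simps)
      also have "\<dots> \<le> 2 ^ k * (C + norm x ^ k * D)"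
        using C[of "y - x"] D[of "y - x"] by (intro mult_left_mono add_mono) auto
      finally show ?thesis .
    qed
    then show ?thesis
      by (auto simp: iter_partial_translate translate_def[of x "iter_partial js f"])
  qed
  moreover have "iter_partial js (translate x f) differentiable (at y)" for js y
    unfolding iter_partial_translate using assms by (intro differentiable_translate) (simp add: schwartz_def)
  ultimately show ?thesis by (auto simp: schwartz_def)
qed

lemma schwartz_continuous:
  assumes "f \<in> schwartz"
  shows "continuous_on UNIV f"
proof -
  have "\<forall>x. iter_partial [] f differentiable (at x)"
    using assms unfolding schwartz_def by blast
  then show ?thesis
    by (simp add: continuous_at_imp_continuous_on differentiable_imp_continuous_within)
qed

lemma schwartz_bounded:
  assumes "f \<in> schwartz"
  obtains C where "\<And>x. cmod (f x) \<le> C"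
proof -
  have "\<exists>C. \<forall>x. norm x ^ 0 * cmod (iter_partial [] f x) \<le> C"
    using assms unfolding schwartz_def by blast
  then show ?thesis using that by auto
qed

lemma schwartz_norm_0:
  assumes "f \<in> schwartz"
  shows "cmod (f x) \<le> schwartz_norm 0 f"
proof -
  obtain C where "\<And>x. cmod (f x) \<le> C"
    using schwartz_bounded[OF assms] by blast
  then have "cmod (f x) \<le> (SUP x. cmod (f x))"
    by (intro cSUP_upper) (auto intro!: bdd_aboveI)
  then show ?thesis by (simp add: schwartz_norm_def)
qed

section \<open>Algebra of time-frequency shifts\<close>

text \<open>With both phases merged into one \<open>cis\<close>, identities between shifts become
  identities between exponents.\<close>

lemma rho_altdef:
  "rho z f t = cis (- (pi * (fst z \<bullet> snd z)) + 2 * pi * (snd z \<bullet> t)) * f (t - fst z)"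
  by (simp only: rho_def modulate_def translate_def cis_mult[symmetric] mult.assoc)

text \<open>The symmetric prefactor in \<open>rho\<close> makes composition projective, with half
  the symplectic form as its only phase.\<close>

lemma rho_rho: "rho z (rho w f) = (\<lambda>t. cis (- (pi * sympl z w)) * rho (z + w) f t)"
proof
  fix t
  have "- (pi * (fst z \<bullet> snd z)) + 2 * pi * (snd z \<bullet> t) + (- (pi * (fst w \<bullet> snd w)) + 2 * pi * (snd w \<bullet> (t - fst z)))
     = - (pi * sympl z w) + (- (pi * (fst (z + w) \<bullet> snd (z + w))) + 2 * pi * (snd (z + w) \<bullet> t))"
    by (simp add: sympl_def inner_simps algebra_simps inner_commute)
  moreover have "t - fst z - fst w = t - fst (z + w)" by simp
  ultimately show "rho z (rho w f) t = cis (- (pi * sympl z w)) * rho (z + w) f t"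
    unfolding rho_altdef mult.assoc[symmetric] cis_mult by (simp add: diff_diff_eq)
qed

lemma rho_0 [simp]: "rho 0 f = f"
  by (simp add: fun_eq_iff rho_altdef)

lemma cmod_rho: "cmod (rho z f t) = cmod (f (t - fst z))"
  by (simp add: rho_altdef norm_mult)

lemma rho_continuous:
  assumes "continuous_on UNIV f"
  shows "continuous_on UNIV (rho z f)"
  unfolding rho_altdef[abs_def]
  by (intro continuous_intros continuous_on_compose2[OF assms]) auto

lemma rho_scale: "rho z (\<lambda>t. a * f t) = (\<lambda>t. a * rho z f t)"
  by (simp add: rho_altdef fun_eq_iff)


section \<open>Pointwise and summability estimates in \<open>M\<^sup>1\<close>\<close>

lemma stft_L2_inner:
  "stft \<phi> (L2_inner h) (x, \<omega>)
     = cis (pi * (x \<bullet> \<omega>)) * (LINT t|lborel. h t * cnj (\<phi> (t - x)) * cis (- (2 * pi * (\<omega> \<bullet> t))))"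
proof -
  have "h t * cnj (rho (x, \<omega>) \<phi> t)
      = cis (pi * (x \<bullet> \<omega>)) * (h t * cnj (\<phi> (t - x)) * cis (- (2 * pi * (\<omega> \<bullet> t))))" for t
    by (simp add: rho_altdef cis_cnj cis_mult[symmetric] diff_conv_add_uminus del: add_uminus_conv_diff)
  then show ?thesis
    unfolding stft_def L2_inner_def by (simp only: integral_mult_right_zero)
qed

text \<open>The function G(x) of the outline.\<close>

definition stft_slice :: "(real^'n \<Rightarrow> complex) \<Rightarrow> (real^'n \<Rightarrow> complex) \<Rightarrow> real^'n \<Rightarrow> real" where
  "stft_slice \<phi> h x = (LINT \<omega>|lborel. cmod (stft \<phi> (L2_inner h) (x, \<omega>)))"

lemma stft_slice_nonneg: "stft_slice \<phi> h x \<ge> 0"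
  by (simp add: stft_slice_def)

lemma stft_slice_integral:
  assumes "h \<in> M1 \<phi>"
  shows "integrable lborel (stft_slice \<phi> h)" and "(LINT x|lborel. stft_slice \<phi> h x) = M1_norm \<phi> h"
proof -
  have i: "integrable (lborel \<Otimes>\<^sub>M lborel) (\<lambda>z. cmod (stft \<phi> (L2_inner h) z))"
    using assms unfolding M1_def lborel_prod by auto
  show "integrable lborel (stft_slice \<phi> h)"
    unfolding stft_slice_def[abs_def] by (rule lborel_pair.integrable_fst'[OF i])
  show "(LINT x|lborel. stft_slice \<phi> h x) = M1_norm \<phi> h"
    unfolding stft_slice_def M1_norm_def lborel_pair.integral_fst'[OF i] lborel_prod ..
qed

text \<open>Fubini makes the slice integrable in frequency for almost every \<open>x\<close> only;
  for each such \<open>x\<close>, Fourier inversion bounds all \<open>t\<close> at once.\<close>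

lemma M1_pointwise_bound:
  assumes "\<phi> \<in> schwartz" "h \<in> M1 \<phi>"
  shows "AE x in lborel. \<forall>t. cmod (h t) * cmod (\<phi> (t - x)) \<le> stft_slice \<phi> h x"
proof -
  let ?V = "stft \<phi> (L2_inner h)"
  have "integrable (lborel \<Otimes>\<^sub>M lborel) ?V"
    using assms unfolding M1_def lborel_prod by auto
  from lborel_pair.AE_integrable_fst'[OF this]
  have "AE x in lborel. integrable lborel (\<lambda>\<omega>. ?V (x, \<omega>))" .
  then show ?thesis
  proof eventually_elim
    case (elim x)
    let ?u = "\<lambda>t. h t * cnj (\<phi> (t - x))"
    let ?U = "\<lambda>\<omega>. LINT t|lborel. ?u t * cis (- (2 * pi * (\<omega> \<bullet> t)))"
    have nU: "cmod (?U \<omega>) = cmod (?V (x, \<omega>))" for \<omega>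
      by (simp add: stft_L2_inner norm_mult)
    have "continuous_on UNIV h" using assms by (simp add: M1_def)
    then have cont: "continuous_on UNIV ?u"
      by (intro continuous_intros continuous_on_compose2[OF schwartz_continuous[OF assms(1)]]) auto
    have int: "integrable lborel ?u"
    proof -
      have "\<forall>f\<in>schwartz. integrable lborel (\<lambda>t. h t * cnj (f t))"
        using assms by (simp add: M1_def)
      from bspec[OF this schwartz_translate[OF assms(1)]] show ?thesis
        by (simp add: translate_def)
    qed
    have U: "?U \<omega> = cis (- (pi * (x \<bullet> \<omega>))) * ?V (x, \<omega>)" for \<omega>
      unfolding stft_L2_inner mult.assoc[symmetric] cis_mult by simp
    have "integrable lborel ?U"
    proof (rule Bochner_Integration.integrable_bound[OF elim])
      show "?U \<in> borel_measurable lborel"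
        unfolding U by (intro borel_measurable_times borel_measurable_integrable[OF elim])
          (auto intro!: borel_measurable_continuous_onI continuous_intros)
    qed (use nU in auto)
    from fourier_inversion_bound[OF cont int this]
    show ?case by (simp add: stft_slice_def nU norm_mult)
  qed
qed

text \<open>The cap 1/4 on the radius is for later: balls of radius \<open>2 * r\<close> around
  points at distance at least 1 are then disjoint.\<close>

lemma nonzero_on_ball:
  fixes f :: "'a::real_normed_vector \<Rightarrow> complex"
  assumes "continuous_on UNIV f" "f \<noteq> (\<lambda>t. 0)"
  obtains c y r where "c > 0" "0 < r" "r \<le> 1/4" "\<And>x. x \<in> ball y r \<Longrightarrow> c \<le> cmod (f x)"
proof -
  from assms(2) obtain y where y: "f y \<noteq> 0" by auto
  have "isCont f y" using assms(1) by (simp add: continuous_on_eq_continuous_at)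
  moreover have "cmod (f y) / 2 > 0" using y by simp
  ultimately obtain e where e: "e > 0" "\<And>x. dist x y < e \<Longrightarrow> dist (f x) (f y) < cmod (f y) / 2"
    unfolding continuous_at_eps_delta by blast
  show thesis
  proof
    show "cmod (f y) / 2 > 0" "min e (1/4) > 0" "min e (1/4) \<le> 1/4" using y e by auto
    fix x assume "x \<in> ball y (min e (1/4))"
    then have "dist (f x) (f y) < cmod (f y) / 2" by (intro e) (auto simp: dist_commute)
    then show "cmod (f y) / 2 \<le> cmod (f x)"
      using norm_triangle_ineq2[of "f y" "f x"] by (simp add: dist_norm norm_minus_commute)
  qed
qed

text \<open>Integrate \<open>c * cmod (h t)\<close> over all pairs with \<open>t - x\<close> in a
  ball where \<open>\<phi>\<close> is bounded below by \<open>c\<close>. Integrating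
  \<open>x\<close> first gives \<open>c * cmod (h t)\<close> times the ball volume; integrating
  \<open>t\<close> first gives at most the slice at \<open>x\<close> times that volume, which is
  integrable.\<close>

lemma M1_integrable:
  fixes \<phi> h :: "real^'n \<Rightarrow> complex"
  assumes "\<phi> \<in> schwartz" "\<phi> \<noteq> (\<lambda>t. 0)" "h \<in> M1 \<phi>"
  shows "integrable lborel h"
proof (rule integrableI_bounded)
  obtain c y r where c: "c > 0" "0 < r" "\<And>x. x \<in> ball y r \<Longrightarrow> c \<le> cmod (\<phi> x)"
    using nonzero_on_ball[OF schwartz_continuous[OF assms(1)] assms(2)] by metis
  have "continuous_on UNIV h" using assms(3) by (simp add: M1_def)
  then show meas: "h \<in> borel_measurable lborel"
    by (simp add: borel_measurable_continuous_onI)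
  note [measurable] = meas[unfolded measurable_lborel2]
  define V where "V = emeasure lborel (ball (0::real^'n) r)"
  have V: "emeasure lborel (ball z r) = V" for z :: "real^'n"
    using c(2) by (simp add: V_def emeasure_ball)
  have Vpos: "V > 0" "V < \<infinity>"
    using c(2) by (auto simp: V_def emeasure_ball zero_less_mult_iff)
  let ?G = "stft_slice \<phi> h"
  let ?f = "\<lambda>x t. ennreal (c * cmod (h t)) * indicator (ball y r) (t - x)"
  have [measurable]: "?G \<in> borel_measurable borel"
    using borel_measurable_integrable[OF stft_slice_integral(1)[OF assms(3)]] by simp
  have fm: "case_prod ?f \<in> borel_measurable (lborel \<Otimes>\<^sub>M lborel)"
  proof -
    have "(\<lambda>p::(real^'n) \<times> (real^'n). snd p - fst p) \<in> measurable (lborel \<Otimes>\<^sub>M lborel) borel"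
      by measurable
    from measurable_compose[OF this borel_measurable_indicator[of "ball y r"]]
    have [measurable]: "(\<lambda>p. indicator (ball y r) (snd p - fst p) :: ennreal) \<in> borel_measurable (lborel \<Otimes>\<^sub>M lborel)"
      by simp
    have "(\<lambda>p. ennreal (c * cmod (h (snd p)))) \<in> borel_measurable (lborel \<Otimes>\<^sub>M lborel)"
      by measurable
    then show ?thesis unfolding case_prod_beta' by measurable
  qed
  have AE: "AE x in lborel. (\<integral>\<^sup>+t. ?f x t \<partial>lborel) \<le> ennreal (?G x) * V"
    using M1_pointwise_bound[OF assms(1,3)]
  proof eventually_elim
    case (elim x)
    have "?f x t \<le> ennreal (?G x) * indicator (ball (y + x) r) t" for t
    proof (cases "t \<in> ball (y + x) r")
      case True
      then have t: "t - x \<in> ball y r" by (simp add: dist_norm algebra_simps)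
      have "c * cmod (h t) \<le> cmod (h t) * cmod (\<phi> (t - x))"
        using mult_left_mono[OF c(3)[OF t], of "cmod (h t)"] by (simp add: mult.commute)
      then have "c * cmod (h t) \<le> ?G x" using elim order_trans by blast
      then show ?thesis using t True by (simp add: ennreal_leI)
    next
      case False
      then have "t - x \<notin> ball y r" by (simp add: dist_norm algebra_simps)
      then show ?thesis by simp
    qed
    then have "(\<integral>\<^sup>+t. ?f x t \<partial>lborel) \<le> (\<integral>\<^sup>+t. ennreal (?G x) * indicator (ball (y + x) r) t \<partial>lborel)"
      by (intro nn_integral_mono) auto
    then show ?case by (simp add: nn_integral_cmult_indicator V)
  qed
  have "(\<integral>\<^sup>+t. ennreal (c * cmod (h t)) \<partial>lborel) * V = (\<integral>\<^sup>+t. ennreal (c * cmod (h t)) * V \<partial>lborel)"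
    by (simp add: nn_integral_multc)
  also have "\<dots> = (\<integral>\<^sup>+t. (\<integral>\<^sup>+x. ?f x t \<partial>lborel) \<partial>lborel)"
  proof (rule nn_integral_cong)
    fix t
    have "indicator (ball y r) (t - x) = (indicator (ball (t - y) r) x :: ennreal)" for x
    proof -
      have "y - (t - x) = - (t - y - x)" by simp
      then have "norm (y - (t - x)) = norm (t - y - x)" by (metis norm_minus_cancel)
      then show ?thesis by (simp add: indicator_def dist_norm)
    qed
    then have "(\<integral>\<^sup>+x. ?f x t \<partial>lborel) = (\<integral>\<^sup>+x. ennreal (c * cmod (h t)) * indicator (ball (t - y) r) x \<partial>lborel)"
      by simp
    then show "ennreal (c * cmod (h t)) * V = (\<integral>\<^sup>+x. ?f x t \<partial>lborel)"
      by (simp add: nn_integral_cmult_indicator V)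
  qed
  also have "\<dots> = (\<integral>\<^sup>+x. (\<integral>\<^sup>+t. ?f x t \<partial>lborel) \<partial>lborel)"
    by (rule lborel_pair.Fubini'[OF fm])
  also have "\<dots> \<le> (\<integral>\<^sup>+x. ennreal (?G x) * V \<partial>lborel)"
    by (rule nn_integral_mono_AE[OF AE])
  also have "\<dots> = ennreal (LINT x|lborel. ?G x) * V"
    using stft_slice_integral(1)[OF assms(3)]
    by (simp add: nn_integral_multc nn_integral_eq_integral stft_slice_nonneg)
  finally have "(\<integral>\<^sup>+t. ennreal (c * cmod (h t)) \<partial>lborel) * V \<le> ennreal (LINT x|lborel. ?G x) * V" .
  also have "\<dots> < \<infinity>" using Vpos by (simp add: ennreal_mult_less_top)
  finally have "(\<integral>\<^sup>+t. ennreal (c * cmod (h t)) \<partial>lborel) < \<infinity>"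
    using Vpos by (auto simp: ennreal_mult_less_top)
  then have "ennreal c * (\<integral>\<^sup>+t. ennreal (cmod (h t)) \<partial>lborel) < \<infinity>"
    using c(1) by (simp add: ennreal_mult nn_integral_cmult)
  then show "(\<integral>\<^sup>+t. ennreal (norm (h t)) \<partial>lborel) < \<infinity>"
    using c(1) by (auto simp: ennreal_mult_less_top)
qed

lemma integrable_mult_bounded:
  fixes f g :: "'a::euclidean_space \<Rightarrow> complex"
  assumes "integrable lborel f" "continuous_on UNIV g" "\<And>x. cmod (g x) \<le> B"
  shows "integrable lborel (\<lambda>x. f x * g x)"
proof (rule Bochner_Integration.integrable_bound)
  show "integrable lborel (\<lambda>x. B * cmod (f x))" using assms(1) by simp
  have "g \<in> borel_measurable lborel" using assms(2) by (simp add: borel_measurable_continuous_onI)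
  then show "(\<lambda>x. f x * g x) \<in> borel_measurable lborel"
    using borel_measurable_integrable[OF assms(1)] by simp
  have "cmod (f x * g x) \<le> \<bar>B * cmod (f x)\<bar>" for x
  proof -
    have "cmod (f x * g x) \<le> cmod (f x) * B"
      using assms(3)[of x] by (simp add: norm_mult mult_left_mono)
    also have "\<dots> \<le> \<bar>B * cmod (f x)\<bar>" using abs_ge_self[of "B * cmod (f x)"] by (simp only: mult.commute)
    finally show ?thesis .
  qed
  then show "AE x in lborel. norm (f x * g x) \<le> norm (B * cmod (f x))" by simp
qed

text \<open>Reduces membership to conditions that are easy to transport: an integrable function
  pairs with Schwartz functions as a distribution of order 0, and integrability itself is
  \<open>M1_integrable\<close>.\<close>

lemma M1_iff:
  fixes \<phi> h :: "real^'n \<Rightarrow> complex"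
  assumes \<phi>: "\<phi> \<in> schwartz" "\<phi> \<noteq> (\<lambda>t. 0)"
  shows "h \<in> M1 \<phi> \<longleftrightarrow> continuous_on UNIV h \<and> integrable lborel h \<and> integrable lborel (stft \<phi> (L2_inner h))"
    (is "_ \<longleftrightarrow> ?P")
proof
  assume h: "h \<in> M1 \<phi>"
  show ?P using M1_integrable[OF \<phi> h] h by (simp add: M1_def)
next
  assume h: ?P
  have int: "integrable lborel (\<lambda>t. h t * cnj (f t))" if "f \<in> schwartz" for f
    using h schwartz_continuous[OF that] schwartz_norm_0[OF that]
    by (intro integrable_mult_bounded[where B = "schwartz_norm 0 f"]) (auto intro!: continuous_intros)
  have "tempered_distribution (L2_inner h)"
    unfolding tempered_distribution_def
  proof (intro conjI ballI allI exI)
    fix f g :: "real^'n \<Rightarrow> complex" and a assume f: "f \<in> schwartz"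
    show "L2_inner h (\<lambda>t. a * f t) = cnj a * L2_inner h f"
      unfolding L2_inner_def by (simp add: mult.left_commute)
    {
      assume g: "g \<in> schwartz"
      show "L2_inner h (\<lambda>t. f t + g t) = L2_inner h f + L2_inner h g"
        unfolding L2_inner_def using int[OF f] int[OF g] by (simp add: distrib_left)
    }
    have "cmod (L2_inner h f) \<le> (LINT t|lborel. cmod (h t * cnj (f t)))"
      unfolding L2_inner_def by (rule integral_norm_bound)
    also have "\<dots> \<le> (LINT t|lborel. cmod (h t) * schwartz_norm 0 f)"
    proof (rule integral_mono)
      show "integrable lborel (\<lambda>t. cmod (h t * cnj (f t)))" using int[OF f] by (rule integrable_norm)
      show "integrable lborel (\<lambda>t. cmod (h t) * schwartz_norm 0 f)" using h by simp
    qed (simp add: norm_mult mult_left_mono schwartz_norm_0[OF f])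
    \<comment> \<open>Fixes the order 0 and the constant, the L^1 norm of \<open>h\<close>, left
      open by the existential.\<close>
    finally show "cmod (L2_inner h f) \<le> (LINT t|lborel. cmod (h t)) * schwartz_norm 0 f" by simp
  qed
  then show "h \<in> M1 \<phi>" using h int by (simp add: M1_def)
qed

section \<open>Amalgam estimate along the lattice\<close>

lemma D_half_dist:
  assumes "\<And>j. d j > 0" "\<gamma> \<in> range (D_half d)" "\<gamma>' \<in> range (D_half d)" "\<gamma> \<noteq> \<gamma>'"
  shows "dist \<gamma> \<gamma>' \<ge> 1"
proof -
  obtain k l where kl: "\<gamma> = D_half d k" "\<gamma>' = D_half d l" using assms by auto
  with assms(4) obtain j where j: "k $ j \<noteq> l $ j" by (metis vec_eq_iff)
  have "1 * 1 \<le> sqrt (real (d j)) * \<bar>real_of_int (k $ j - l $ j)\<bar>"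
    using assms(1)[of j] j by (intro mult_mono) auto
  also have "\<dots> = \<bar>(\<gamma> - \<gamma>') $ j\<bar>"
    by (simp add: kl D_half_def right_diff_distrib[symmetric] abs_mult)
  also have "\<dots> \<le> dist \<gamma> \<gamma>'" unfolding dist_norm by (rule component_le_norm_cart)
  finally show ?thesis by simp
qed

text \<open>Membership in a Wiener amalgam space. The constants are uniform in \<open>h\<close> and
  \<open>t0\<close>, which gives boundedness of the Zak functional; the majorant \<open>m\<close> is
  uniform in \<open>s\<close>, which gives continuity in the displacement.\<close>

lemma M1_amalgam:
  fixes \<phi> :: "real^'n \<Rightarrow> complex"
  assumes \<phi>: "\<phi> \<in> schwartz" "\<phi> \<noteq> (\<lambda>t. 0)" and d: "\<And>j. d j > 0"
  shows "\<exists>C. \<exists>r>0. \<forall>h\<in>M1 \<phi>. \<forall>t0. \<exists>m. m summable_on range (D_half d)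
    \<and> infsum m (range (D_half d)) \<le> C * M1_norm \<phi> h
    \<and> (\<forall>\<gamma>\<in>range (D_half d). \<forall>s. norm s < r \<longrightarrow> cmod (h (t0 - \<gamma> + s)) \<le> m \<gamma>)"
proof -
  obtain c y r where c: "c > 0" "0 < r" "r \<le> 1/4" "\<And>x. x \<in> ball y r \<Longrightarrow> c \<le> cmod (\<phi> x)"
    using nonzero_on_ball[OF schwartz_continuous[OF \<phi>(1)] \<phi>(2)] by metis
  define V where "V = measure lborel (ball (0::real^'n) r)"
  have V: "measure lborel (ball z r) = V" for z :: "real^'n"
    using c(2) by (simp add: V_def content_ball)
  have Vpos: "V > 0"
    using c(2) by (simp add: V_def content_ball)
  let ?\<Gamma> = "range (D_half d)"
  show ?thesis
  proof (rule exI[of _ "1 / (c * V)"], rule exI[of _ r], intro conjI ballI allI)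
    show "r > 0" by fact
    fix h t0 assume h: "h \<in> M1 \<phi>"
    let ?G = "stft_slice \<phi> h"
    let ?B = "\<lambda>\<gamma>. ball (t0 - \<gamma> - y) (2 * r)"
    \<comment> \<open>The slice integrated over a ball. Radius \<open>2 * r\<close> leaves room for
      displacements: for \<open>norm s < r\<close> it contains the ball of radius \<open>r\<close>
      around \<open>t0 - \<gamma> + s - y\<close>.\<close>
    define m where "m = (\<lambda>\<gamma>. (LINT x|lborel. indicator (?B \<gamma>) x *\<^sub>R ?G x) / (c * V))"
    note G = stft_slice_integral[OF h]
    have GB: "integrable lborel (\<lambda>x. indicator (?B \<gamma>) x *\<^sub>R ?G x)" for \<gamma>
      using G(1) by (intro integrable_mult_indicator) auto
    have m0: "m \<gamma> \<ge> 0" for \<gamma>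
      using c(1) Vpos by (auto simp: m_def stft_slice_nonneg intro!: Bochner_Integration.integral_nonneg)
    have fin: "sum m F \<le> 1 / (c * V) * M1_norm \<phi> h" if F: "finite F" "F \<subseteq> ?\<Gamma>" for F
    proof -
      \<comment> \<open>Lattice points are at distance at least 1, and
        \<open>2 * r + 2 * r \<le> 1\<close>. The sum of the integrals is therefore at most one
        integral of the slice.\<close>
      have dis: "disjoint_family_on ?B F"
        unfolding disjoint_family_on_def
      proof (intro ballI impI)
        fix \<gamma> \<gamma>' assume "\<gamma> \<in> F" "\<gamma>' \<in> F" "\<gamma> \<noteq> \<gamma>'"
        then have "dist \<gamma> \<gamma>' \<ge> 1" using F(2) by (intro D_half_dist[OF d]) auto
        moreover have "dist (t0 - \<gamma> - y) (t0 - \<gamma>' - y) = dist \<gamma> \<gamma>'"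
          by (simp add: dist_norm norm_minus_commute)
        ultimately show "?B \<gamma> \<inter> ?B \<gamma>' = {}"
          using c(3) by (intro disjoint_ballI) auto
      qed
      have "(\<Sum>\<gamma>\<in>F. (LINT x|lborel. indicator (?B \<gamma>) x *\<^sub>R ?G x)) = (LINT x|lborel. (\<Sum>\<gamma>\<in>F. indicator (?B \<gamma>) x *\<^sub>R ?G x))"
        by (rule Bochner_Integration.integral_sum[symmetric]) (rule GB)
      also have "\<dots> \<le> (LINT x|lborel. ?G x)"
      proof (intro integral_mono G Bochner_Integration.integrable_sum GB)
        fix x
        have "(\<Sum>\<gamma>\<in>F. indicator (?B \<gamma>) x *\<^sub>R ?G x) = indicator (\<Union>(?B ` F)) x * ?G x"
          by (simp add: indicator_UN_disjoint[OF F(1) dis] sum_distrib_right)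
        also have "\<dots> \<le> ?G x" by (simp add: indicator_def stft_slice_nonneg)
        finally show "(\<Sum>\<gamma>\<in>F. indicator (?B \<gamma>) x *\<^sub>R ?G x) \<le> ?G x" .
      qed
      finally show ?thesis
        using c(1) Vpos G(2) by (simp add: m_def sum_divide_distrib[symmetric] divide_right_mono)
    qed
    have summ: "m summable_on ?\<Gamma>"
      using m0 fin by (intro nonneg_bdd_above_summable_on) (auto intro!: bdd_aboveI2)
    have "cmod (h (t0 - \<gamma> + s)) \<le> m \<gamma>" if "norm s < r" for \<gamma> s
    proof -
      let ?t = "t0 - \<gamma> + s"
      \<comment> \<open>Averaging: the pointwise bound holds only for almost every \<open>x\<close>,
        so the constant \<open>c * cmod (h ?t)\<close> is integrated over a whole ball of
        positions.\<close>
      have "c * cmod (h ?t) * V = (LINT x|lborel. indicator (ball (?t - y) r) x *\<^sub>R (c * cmod (h ?t)))"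
        by (simp add: V)
      also have "\<dots> \<le> (LINT x|lborel. indicator (?B \<gamma>) x *\<^sub>R ?G x)"
      proof (rule integral_mono_AE)
        show "integrable lborel (\<lambda>x. indicator (ball (?t - y) r) x *\<^sub>R (c * cmod (h ?t)))"
          using emeasure_lborel_ball_finite[of "?t - y" r] by (intro integrable_scaleR_left integrable_real_indicator) auto
        show "AE x in lborel. indicator (ball (?t - y) r) x *\<^sub>R (c * cmod (h ?t)) \<le> indicator (?B \<gamma>) x *\<^sub>R ?G x"
          using M1_pointwise_bound[OF \<phi>(1) h]
        proof eventually_elim
          case (elim x)
          show ?case
          proof (cases "x \<in> ball (?t - y) r")
            case True
            have "y - (?t - x) = - (?t - y - x)" by simp
            then have "norm (y - (?t - x)) = norm (?t - y - x)" by (metis norm_minus_cancel)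
            then have "?t - x \<in> ball y r" using True by (simp add: dist_norm)
            then have "c * cmod (h ?t) \<le> cmod (h ?t) * cmod (\<phi> (?t - x))"
              using mult_left_mono[OF c(4), of "?t - x" "cmod (h ?t)"] by (simp add: mult.commute)
            then have *: "c * cmod (h ?t) \<le> ?G x" using elim order_trans by blast
            have "dist (t0 - \<gamma> - y) x \<le> dist (t0 - \<gamma> - y) (?t - y) + dist (?t - y) x"
              by (rule dist_triangle)
            also have "dist (t0 - \<gamma> - y) (?t - y) < r" using that by (simp add: dist_norm)
            finally have "x \<in> ?B \<gamma>" using True by simp
            then show ?thesis using True * by simp
          qed (simp add: stft_slice_nonneg)
        qed
      qed (rule GB)
      finally show ?thesis
        using c(1) Vpos by (simp add: m_def field_simps)
    qed
    moreover have "infsum m ?\<Gamma> \<le> 1 / (c * V) * M1_norm \<phi> h"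
      by (rule infsum_le_finite_sums[OF summ fin])
    ultimately show "\<exists>m. m summable_on ?\<Gamma> \<and> infsum m ?\<Gamma> \<le> 1 / (c * V) * M1_norm \<phi> h
        \<and> (\<forall>\<gamma>\<in>?\<Gamma>. \<forall>s. norm s < r \<longrightarrow> cmod (h (t0 - \<gamma> + s)) \<le> m \<gamma>)"
      using summ by blast
  qed
qed

section \<open>M^1 as a vector space invariant under time-frequency shifts\<close>

context
  fixes \<phi> :: "real^'n \<Rightarrow> complex"
  assumes \<phi>: "\<phi> \<in> schwartz" "\<phi> \<noteq> (\<lambda>t. 0)"
begin

lemma M1_stft_integrable:
  assumes "h \<in> M1 \<phi>"
  shows "integrable lborel (\<lambda>t. h t * cnj (rho z \<phi> t))"
proof -
  obtain B where "\<And>t. cmod (\<phi> t) \<le> B" using schwartz_bounded[OF \<phi>(1)] by blast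
  then show ?thesis
    using M1_integrable[OF \<phi> assms] rho_continuous[OF schwartz_continuous[OF \<phi>(1)], of z]
    by (intro integrable_mult_bounded[where B = B]) (auto intro!: continuous_intros simp: cmod_rho)
qed

lemma M1_add:
  assumes "h \<in> M1 \<phi>" "k \<in> M1 \<phi>"
  shows "(\<lambda>t. h t + k t) \<in> M1 \<phi>"
proof -
  have "stft \<phi> (L2_inner (\<lambda>t. h t + k t)) = (\<lambda>z. stft \<phi> (L2_inner h) z + stft \<phi> (L2_inner k) z)"
    using M1_stft_integrable[OF assms(1)] M1_stft_integrable[OF assms(2)]
    by (simp add: stft_def L2_inner_def fun_eq_iff distrib_right)
  then show ?thesis
    using assms unfolding M1_iff[OF \<phi>] by (auto intro!: continuous_intros)
qed

lemma M1_scale: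
  assumes "h \<in> M1 \<phi>"
  shows "(\<lambda>t. a * h t) \<in> M1 \<phi>"
proof -
  have "stft \<phi> (L2_inner (\<lambda>t. a * h t)) = (\<lambda>z. a * stft \<phi> (L2_inner h) z)"
    by (simp add: stft_def L2_inner_def fun_eq_iff mult.assoc)
  then show ?thesis
    using assms unfolding M1_iff[OF \<phi>] by (auto intro!: continuous_intros)
qed

lemma M1_sum:
  assumes "finite A" "\<And>s. s \<in> A \<Longrightarrow> g s \<in> M1 \<phi>"
  shows "(\<lambda>t. \<Sum>s\<in>A. g s t) \<in> M1 \<phi>"
  using assms
proof (induction rule: finite_induct)
  case empty
  have "(\<lambda>t. 0) \<in> M1 \<phi>"
    unfolding M1_iff[OF \<phi>] by (simp add: stft_def[abs_def] L2_inner_def)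
  then show ?case by simp
qed (auto intro: M1_add)

text \<open>Unitarity of the shifts: substitute \<open>fst z + t\<close> and compare the two
  phases.\<close>

lemma L2_inner_rho:
  assumes "h \<in> borel_measurable borel" "k \<in> borel_measurable borel"
  shows "L2_inner (rho z h) k = L2_inner h (rho (- z) k)"
proof -
  have [measurable]: "rho z h \<in> borel_measurable borel"
  proof -
    have "(\<lambda>t. cis (- (pi * (fst z \<bullet> snd z)) + 2 * pi * (snd z \<bullet> t))) \<in> borel_measurable borel"
      by (auto intro!: borel_measurable_continuous_onI continuous_intros)
    with assms(1) show ?thesis unfolding rho_altdef[abs_def] by measurable
  qed
  have "L2_inner (rho z h) k = (LINT t|lborel. rho z h (fst z + t) * cnj (k (fst z + t)))"
  proof -
    have "(\<lambda>t. rho z h t * cnj (k t)) \<in> borel_measurable borel"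
    proof -
      have "cnj \<in> borel_measurable borel"
        by (intro borel_measurable_continuous_onI continuous_intros)
      note [measurable] = measurable_compose[OF assms(2) this]
      show ?thesis by measurable
    qed
    from lborel_integral_shift(1)[OF this, of "fst z"] show ?thesis
      unfolding L2_inner_def by simp
  qed
  also have "\<dots> = L2_inner h (rho (- z) k)"
    unfolding L2_inner_def
  proof (rule Bochner_Integration.integral_cong)
    fix t
    have "cis (- (pi * (fst z \<bullet> snd z)) + 2 * pi * (snd z \<bullet> (fst z + t)))
        = cnj (cis (- (pi * (fst (- z) \<bullet> snd (- z))) + 2 * pi * (snd (- z) \<bullet> t)))"
      unfolding cis_cnj by (rule arg_cong[where f = cis]) (simp add: inner_simps inner_commute algebra_simps)
    then show "rho z h (fst z + t) * cnj (k (fst z + t)) = h t * cnj (rho (- z) k t)"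
      unfolding rho_altdef by (simp add: add.commute)
  qed simp
  finally show ?thesis .
qed

text \<open>The short-time Fourier transform of the shifted function is the old one translated by
  \<open>z\<close>, times a unimodular phase; both changes preserve integrability.\<close>

lemma M1_rho:
  assumes "h \<in> M1 \<phi>"
  shows "rho z h \<in> M1 \<phi>"
proof -
  have h: "continuous_on UNIV h" "integrable lborel h" "integrable lborel (stft \<phi> (L2_inner h))"
    using assms by (auto simp: M1_iff[OF \<phi>])
  let ?V = "stft \<phi> (L2_inner h)"
  have V: "integrable lborel (\<lambda>w. ?V (- z + w))"
    using lborel_integral_shift(2)[of ?V "- z"] borel_measurable_integrable[OF h(3)] h(3) by simp
  have "stft \<phi> (L2_inner (rho z h)) w = ?V (- z + w) * cis (- (pi * sympl z w))" for w
  proof -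
    have "stft \<phi> (L2_inner (rho z h)) w = L2_inner h (rho (- z) (rho w \<phi>))"
      unfolding stft_def
      by (intro L2_inner_rho borel_measurable_continuous_onI h(1) rho_continuous schwartz_continuous \<phi>(1))
    also have "\<dots> = (LINT t|lborel. (h t * cnj (rho (- z + w) \<phi> t)) * cis (- (pi * sympl z w)))"
      unfolding rho_rho L2_inner_def
      by (rule Bochner_Integration.integral_cong) (simp_all add: cis_cnj sympl_def right_diff_distrib)
    also have "\<dots> = ?V (- z + w) * cis (- (pi * sympl z w))"
      unfolding stft_def L2_inner_def by (rule integral_mult_left_zero)
    finally show ?thesis .
  qed
  moreover have "integrable lborel (\<lambda>w. ?V (- z + w) * cis (- (pi * sympl z w)))"
    by (rule integrable_mult_bounded[OF V, where B = 1]) (auto simp: sympl_def intro!: continuous_intros)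
  ultimately have 1: "integrable lborel (stft \<phi> (L2_inner (rho z h)))"
    by (simp add: fun_eq_iff cong: Bochner_Integration.integrable_cong)
  have "integrable lborel (\<lambda>t. h (- fst z + t) * cis (- (pi * (fst z \<bullet> snd z)) + 2 * pi * (snd z \<bullet> t)))"
    using lborel_integral_shift(2)[of h "- fst z"] borel_measurable_integrable[OF h(2)] h(2)
    by (intro integrable_mult_bounded[where B = 1]) (auto intro!: continuous_intros)
  then have "integrable lborel (rho z h)"
    unfolding rho_altdef[abs_def] by (simp add: mult.commute)
  with 1 rho_continuous[OF h(1)] show ?thesis by (simp add: M1_iff[OF \<phi>])
qed

end


section \<open>Covariance of the blocks\<close>

text \<open>Off M^1 the value is the default 0; if scaling by \<open>a\<close> leads into M^1,
  scaling back by \<open>1 / a\<close> relates the two values. Phases can thus be pulled out of any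
  argument.\<close>

lemma Minf_scale:
  assumes "F \<in> Minf \<phi>" "a \<noteq> 0"
  shows "F (\<lambda>t. a * h t) = cnj a * F h"
proof (cases "h \<in> M1 \<phi>")
  case False
  have M: "\<And>b k. k \<in> M1 \<phi> \<Longrightarrow> F (\<lambda>t. b * k t) = cnj b * F k" "\<And>k. k \<notin> M1 \<phi> \<Longrightarrow> F k = 0"
    using assms(1) by (auto simp: Minf_def)
  show ?thesis
  proof (cases "(\<lambda>t. a * h t) \<in> M1 \<phi>")
    case True
    from M(1)[OF True, of "1 / a"] assms(2) have "F h = cnj (1 / a) * F (\<lambda>t. a * h t)" by simp
    with assms(2) show ?thesis by simp
  qed (use False M(2) in auto)
qed (use assms in \<open>auto simp: Minf_def\<close>)

section \<open>Lattice arithmetic and the sign character\<close>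

lemma D_half_add: "D_half d (k + l) = D_half d k + D_half d l"
  by (simp add: D_half_def vec_eq_iff distrib_left)

lemma D_half_uminus: "D_half d (- k) = - D_half d k"
  by (simp add: D_half_def vec_eq_iff)

lemma D_neg_half_add: "D_neg_half d (k + l) = D_neg_half d k + D_neg_half d l"
  by (simp add: D_neg_half_def vec_eq_iff add_divide_distrib)

lemma D_neg_half_diff: "D_neg_half d (k - l) = D_neg_half d k - D_neg_half d l"
  by (simp add: D_neg_half_def vec_eq_iff diff_divide_distrib)

text \<open>Turns a change of integer representative modulo \<open>d\<close> into a lattice
  translation.\<close>

lemma D_neg_half_multiple: "D_neg_half d (\<chi> j. int (d j) * k $ j) = D_half d k"
proof -
  have "real (d j) * x / sqrt (real (d j)) = sqrt (real (d j)) * x" for j x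
    using real_div_sqrt[of "real (d j)"] by (metis of_nat_0_le_iff times_divide_eq_left)
  then show ?thesis by (simp add: D_neg_half_def D_half_def vec_eq_iff)
qed

lemma D_half_inner_neg_half:
  assumes "\<And>j. d j > 0"
  shows "D_half d k \<bullet> D_neg_half d r \<in> \<int>"
proof -
  have "D_half d k $ j \<bullet> D_neg_half d r $ j \<in> \<int>" for j
    using assms[of j] by (simp add: D_half_def D_neg_half_def)
  then show ?thesis unfolding inner_vec_def by (intro Ints_sum)
qed

lemma D_half_inner_half: "D_half d k \<bullet> D_half d m = of_int (\<Sum>j\<in>UNIV. k $ j * int (d j) * m $ j)"
  by (simp add: inner_vec_def D_half_def) (rule sum.cong, auto simp: algebra_simps)

lemma D_half_inner_half_Ints: "D_half d k \<bullet> D_half d m \<in> \<int>"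
  unfolding D_half_inner_half by (rule Ints_of_int)

lemma cis_add_Ints: "x \<in> \<int> \<Longrightarrow> cis (y + 2 * pi * x) = cis y"
  by (simp add: cis_mult[symmetric])

lemma uminus_Lat: "l \<in> Lat d \<Longrightarrow> - l \<in> Lat d"
  by (auto simp: Lat_def D_half_uminus[symmetric])

text \<open>On the lattice the exponent of the sign is the integer
  \<open>fst l \<bullet> snd l\<close>, so \<open>cis\<close> of plus or minus \<open>pi\<close>
  times it agree. The minus sign matches the prefactor of \<open>rho\<close>.\<close>

lemma chi_eq_cis:
  assumes d: "\<And>j. d j > 0" and "l \<in> Lat d"
  shows "chi d l = cis (- (pi * (fst l \<bullet> snd l)))"
proof -
  obtain k m where l: "l = (D_half d k, D_half d m)"
    using assms(2) by (auto simp: Lat_def)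
  have fl: "\<lfloor>D_half d v $ j / sqrt (real (d j))\<rfloor> = v $ j" for v j
    using d[of j] by (simp add: D_half_def)
  have "chi d l = cis pi powi (\<Sum>j\<in>UNIV. k $ j * int (d j) * m $ j)"
    unfolding chi_def l fst_conv snd_conv fl by simp
  also have "\<dots> = cis (pi * (fst l \<bullet> snd l))"
    unfolding cis_power_int l fst_conv snd_conv D_half_inner_half by (simp add: mult.commute)
  also have "\<dots> = cis (- (pi * (fst l \<bullet> snd l)) + 2 * pi * (fst l \<bullet> snd l))"
    by (rule arg_cong[where f = cis]) simp
  also have "\<dots> = cis (- (pi * (fst l \<bullet> snd l)))"
    unfolding l fst_conv snd_conv by (rule cis_add_Ints[OF D_half_inner_half_Ints])
  finally show ?thesis .
qed

text \<open>Invariance is applied at \<open>- l\<close>, since \<open>rho_dual (- l)\<close>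
  evaluates at \<open>rho l h\<close>; the sign is even and squares to 1.\<close>

lemma code_space_Lat:
  assumes "f \<in> code_space \<phi> d" "l \<in> Lat d" "\<And>j. d j > 0"
  shows "f (rho l h) = chi d l * f h"
proof -
  have "(\<lambda>h. chi d (- l) * rho_dual (- l) f h) = f"
    using assms(1) uminus_Lat[OF assms(2)] by (auto simp: code_space_def)
  from fun_cong[OF this, of h] have "chi d (- l) * f (rho l h) = f h"
    by (simp add: rho_dual_def)
  moreover have "chi d (- l) = chi d l"
    by (simp add: chi_eq_cis[of d, OF assms(3)] assms(2) uminus_Lat)
  moreover have "chi d l * chi d l = 1"
    by (simp add: chi_def power_int_mult_distrib[symmetric])
  ultimately show ?thesis
    by (metis mult.assoc mult_1)
qed

lemma block_covariant:
  assumes f: "f \<in> code_space \<phi> d" and l: "l \<in> Lat d" and d: "\<And>j. d j > 0"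
  shows "block d rep g \<alpha> \<zeta> f l q = chi d l * cis (2 * pi * sympl l \<zeta>) * block d rep g \<alpha> \<zeta> f 0 q"
proof -
  let ?\<nu> = "nu d rep q" and ?h = "window_comb g \<alpha>"
  have F: "f \<in> Minf \<phi>" using f by (simp add: code_space_def)
  \<comment> \<open>The first term is the cost of exchanging \<open>rho (- \<zeta>)\<close> and
    \<open>rho l\<close>, the second that of splitting \<open>rho (l + ?\<nu>)\<close> into a
    product.\<close>
  let ?\<theta> = "2 * pi * sympl \<zeta> l + pi * sympl l ?\<nu>"
  have "rho (- \<zeta>) (rho (l + ?\<nu>) ?h) = (\<lambda>t. cis ?\<theta> * rho l (rho (- \<zeta>) (rho ?\<nu> ?h)) t)"
  proof
    fix t
    have 1: "- \<zeta> + (l + ?\<nu>) = l + (- \<zeta> + ?\<nu>)" by simp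
    have 2: "- (pi * sympl (- \<zeta>) (l + ?\<nu>))
       = ?\<theta> + (- (pi * sympl (- \<zeta>) ?\<nu>) + - (pi * sympl l (- \<zeta> + ?\<nu>)))"
      by (simp add: sympl_def inner_simps inner_commute algebra_simps)
    show "rho (- \<zeta>) (rho (l + ?\<nu>) ?h) t = cis ?\<theta> * rho l (rho (- \<zeta>) (rho ?\<nu> ?h)) t"
      unfolding rho_rho rho_scale 1 2 by (simp only: cis_mult[symmetric] mult.assoc)
  qed
  then have "f (rho (- \<zeta>) (rho (l + ?\<nu>) ?h)) = cis (- ?\<theta>) * chi d l * f (rho (- \<zeta>) (rho ?\<nu> ?h))"
    by (simp only: Minf_scale[OF F cis_neq_zero] cis_cnj code_space_Lat[OF f l d] mult.assoc)
  \<comment> \<open>Conjugate linearity has turned \<open>?\<theta>\<close> into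
    \<open>- ?\<theta>\<close>. The weight in the block cancels its part in \<open>?\<nu>\<close>,
    so the remaining factor is the same for all \<open>q\<close>.\<close>
  moreover have "cis (pi * sympl l ?\<nu>) * cis (- ?\<theta>) = cis (2 * pi * sympl l \<zeta>)"
    unfolding cis_mult by (rule arg_cong[where f = cis]) (simp add: sympl_def inner_commute algebra_simps)
  then have "cis (pi * sympl l ?\<nu>) * (cis (- ?\<theta>) * X) = cis (2 * pi * sympl l \<zeta>) * X" for X
    by (simp only: mult.assoc[symmetric])
  moreover have "sympl 0 ?\<nu> = 0" by (simp add: sympl_def)
  ultimately show ?thesis
    by (simp add: block_def adj_coeff_def rho_dual_def mult_ac)
qed

lemma l2_inner_self: "l2_inner I u u = of_real ((l2_norm I u)\<^sup>2)"
proof -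
  have "(l2_norm I u)\<^sup>2 = (\<Sum>i\<in>I. (cmod (u i))\<^sup>2)"
    by (simp add: l2_norm_def sum_nonneg)
  then show ?thesis
    by (simp only: l2_inner_def of_real_sum complex_norm_square)
qed

lemma l2_norm_eq_0:
  assumes "finite I"
  shows "l2_norm I u = 0 \<longleftrightarrow> (\<forall>i\<in>I. u i = 0)"
  using assms by (simp add: l2_norm_def sum_nonneg_eq_0_iff)

lemma finite_Zd: "finite (Zd d :: (int^'n::finite) set)"
proof (rule finite_subset)
  show "Zd d \<subseteq> (\<lambda>f. \<chi> j. f j) ` (\<Pi>\<^sub>E j\<in>UNIV. {0..<int (d j)})"
  proof
    fix r assume "r \<in> Zd d"
    then have "r = (\<chi> j. (\<lambda>j. r $ j) j) \<and> (\<lambda>j. r $ j) \<in> (\<Pi>\<^sub>E j\<in>UNIV. {0..<int (d j)})"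
      by (auto simp: Zd_def vec_eq_iff)
    then show "r \<in> (\<lambda>f. \<chi> j. f j) ` (\<Pi>\<^sub>E j\<in>UNIV. {0..<int (d j)})" by blast
  qed
qed (intro finite_imageI finite_PiE, auto)

lemma finite_KD: "finite (KD d)"
  by (simp add: KD_def finite_Zd)

text \<open>By covariance the block at \<open>l\<close> is a scalar multiple of the block at 0, and
  the quotient recovers the scalar.\<close>

lemma block_ratio:
  assumes f: "f \<in> code_space \<phi> d" and l: "l \<in> Lat d" and d: "\<And>j. d j > 0"
    and nz: "block d rep g \<alpha> \<zeta> f 0 \<noteq> (\<lambda>q. 0)"
  shows "l2_inner (KD d) (block d rep g \<alpha> \<zeta> f l) (block d rep g \<alpha> \<zeta> f 0)
           / of_real ((l2_norm (KD d) (block d rep g \<alpha> \<zeta> f 0))\<^sup>2)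
         = chi d l * cis (2 * pi * sympl l \<zeta>)"
proof -
  let ?B = "block d rep g \<alpha> \<zeta> f 0"
  from nz obtain q where "?B q \<noteq> 0" unfolding fun_eq_iff by blast
  \<comment> \<open>Blocks vanish off \<open>KD d\<close>, so the nonzero entry is seen by the
    norm.\<close>
  then have "l2_norm (KD d) ?B \<noteq> 0"
    unfolding l2_norm_eq_0[OF finite_KD] by (auto simp: block_def split: if_splits)
  moreover have "l2_inner (KD d) (block d rep g \<alpha> \<zeta> f l) ?B
      = chi d l * cis (2 * pi * sympl l \<zeta>) * l2_inner (KD d) ?B ?B"
    unfolding l2_inner_def block_covariant[OF f l d, of rep g \<alpha> \<zeta>] sum_distrib_left
    by (simp only: mult.assoc)
  ultimately show ?thesis by (simp add: l2_inner_self)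
qed


section \<open>Zak transform at the origin and stability\<close>

lemma zak_0: "zak d h x 0 = (\<Sum>\<^sub>\<infinity>\<gamma>\<in>range (D_half d). h (x - \<gamma>))"
  by (simp add: zak_def)

lemma zak_vec_0: "zak_vec d h 0 0 r = (if r \<in> Zd d then zak d h (D_neg_half d r) 0 else 0)"
  by (simp add: zak_vec_def)

text \<open>Translation by a lattice vector permutes the index set of the sum.\<close>

lemma zak_periodic: "zak d h (x + D_half d k) 0 = zak d h x 0"
proof -
  have "bij_betw (\<lambda>\<gamma>. \<gamma> + D_half d k) (range (D_half d)) (range (D_half d))"
  proof (rule bij_betwI[where g = "\<lambda>\<gamma>. \<gamma> + D_half d (- k)"])
    show "(\<lambda>\<gamma>. \<gamma> + D_half d k) \<in> range (D_half d) \<rightarrow> range (D_half d)"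
      "(\<lambda>\<gamma>. \<gamma> + D_half d (- k)) \<in> range (D_half d) \<rightarrow> range (D_half d)"
      by (auto simp: D_half_add[symmetric])
  qed (auto simp: D_half_uminus)
  from infsum_reindex_bij_betw[OF this, of "\<lambda>\<gamma>. h (x + D_half d k - \<gamma>)"]
  show ?thesis unfolding zak_0 by simp
qed

text \<open>When the frequency pairs integrally with the lattice, the modulation takes one value on
  all terms and leaves the sum. Elements of \<open>Lat d\<close> and the shifts \<open>nu\<close>
  both satisfy this.\<close>

lemma zak_rho:
  assumes "\<And>k. snd z \<bullet> D_half d k \<in> \<int>"
  shows "zak d (rho z h) x 0
    = cis (- (pi * (fst z \<bullet> snd z)) + 2 * pi * (snd z \<bullet> x)) * zak d h (x - fst z) 0"
proof -
  have "rho z h (x - \<gamma>) = cis (- (pi * (fst z \<bullet> snd z)) + 2 * pi * (snd z \<bullet> x)) * h (x - fst z - \<gamma>)"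
    if "\<gamma> \<in> range (D_half d)" for \<gamma>
  proof -
    from that obtain k where k: "\<gamma> = D_half d k" by auto
    have "cis (- (pi * (fst z \<bullet> snd z)) + 2 * pi * (snd z \<bullet> (x - \<gamma>)))
        = cis (- (pi * (fst z \<bullet> snd z)) + 2 * pi * (snd z \<bullet> x) + 2 * pi * (- (snd z \<bullet> \<gamma>)))"
      by (rule arg_cong[where f = cis]) (simp add: inner_diff_right right_diff_distrib)
    also have "\<dots> = cis (- (pi * (fst z \<bullet> snd z)) + 2 * pi * (snd z \<bullet> x))"
      using assms[of k] by (intro cis_add_Ints) (simp add: k)
    finally show ?thesis by (simp only: rho_altdef cancel_ab_semigroup_add_class.diff_right_commute[of x \<gamma>])
  qed
  then show ?thesis
    unfolding zak_0 by (subst infsum_cmult_right'[symmetric]) (rule infsum_cong)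
qed

text \<open>Periodicity absorbs the translation and integrality the modulation at the sample points;
  the prefactor of \<open>rho\<close> that remains is the sign.\<close>

lemma zak_vec_rho_Lat:
  assumes d: "\<And>j. d j > 0" and l: "l \<in> Lat d"
  shows "zak_vec d (rho l h) 0 0 r = chi d l * zak_vec d h 0 0 r"
proof -
  obtain k m where l': "l = (D_half d k, D_half d m)"
    using l by (auto simp: Lat_def)
  have "zak d (rho l h) (D_neg_half d r) 0
      = cis (- (pi * (fst l \<bullet> snd l)) + 2 * pi * (snd l \<bullet> D_neg_half d r)) * zak d h (D_neg_half d r - fst l) 0"
    by (rule zak_rho) (simp add: l' D_half_inner_half_Ints)
  also have "cis (- (pi * (fst l \<bullet> snd l)) + 2 * pi * (snd l \<bullet> D_neg_half d r)) = cis (- (pi * (fst l \<bullet> snd l)))"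
    unfolding l' snd_conv by (rule cis_add_Ints[OF D_half_inner_neg_half[OF d]])
  also have "zak d h (D_neg_half d r - fst l) 0 = zak d h (D_neg_half d r) 0"
    using zak_periodic[of d h "D_neg_half d r - fst l" k] by (simp add: l')
  finally show ?thesis
    by (simp add: zak_vec_0 chi_eq_cis[OF d l])
qed

text \<open>Subtracting \<open>X a s0\<close> times the relation from its shift by \<open>s0\<close> removes the term of \<open>a\<close> (Dedekind).\<close>

lemma characters_independent:
  fixes X :: "'p \<Rightarrow> 'g::ab_group_add \<Rightarrow> complex"
  assumes "finite A"
    and hom: "\<And>p s t. p \<in> A \<Longrightarrow> X p (s + t) = X p s * X p t" "\<And>p. p \<in> A \<Longrightarrow> X p 0 = 1"
    and dist: "\<And>p p'. p \<in> A \<Longrightarrow> p' \<in> A \<Longrightarrow> p \<noteq> p' \<Longrightarrow> \<exists>s. X p s \<noteq> X p' s"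
    and zero: "\<And>s. (\<Sum>p\<in>A. u p * X p s) = 0"
    and p: "p \<in> A"
  shows "u p = 0"
  using assms
proof (induction A arbitrary: u p rule: finite_induct)
  case (insert a A)
  have *: "u p = 0" if p: "p \<in> A" for p
  proof -
    obtain s0 where s0: "X p s0 \<noteq> X a s0"
      using insert.prems(3)[of p a] p insert.hyps by auto
    have "(u p * (X p s0 - X a s0)) = 0"
    proof (rule insert.IH[OF _ _ _ _ p])
      fix s
      have "(\<Sum>p\<in>insert a A. u p * X p (s0 + s)) - X a s0 * (\<Sum>p\<in>insert a A. u p * X p s) = 0"
        by (simp only: insert.prems(4) mult_zero_right diff_self)
      also have "(\<Sum>p\<in>insert a A. u p * X p (s0 + s)) - X a s0 * (\<Sum>p\<in>insert a A. u p * X p s)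
          = (\<Sum>p\<in>insert a A. u p * (X p s0 - X a s0) * X p s)"
        unfolding sum_distrib_left sum_subtractf[symmetric]
        by (rule sum.cong) (auto simp: insert.prems(1) algebra_simps)
      finally show "(\<Sum>p\<in>A. u p * (X p s0 - X a s0) * X p s) = 0"
        using insert.hyps by simp
    qed (use insert.prems in auto)
    with s0 show ?thesis by simp
  qed
  moreover have "u a = 0"
    using insert.prems(4)[of 0] insert.hyps insert.prems(2)[of a] * by simp
  ultimately show ?case using insert.prems(5) by auto
qed simp

section \<open>Characters of the finite index group\<close>

lemma cis_eq_imp_Ints:
  assumes "cis (2 * pi * x) = cis (2 * pi * y)"
  shows "x - y \<in> \<int>"
proof -
  have "exp (\<i> * complex_of_real (2 * pi * x)) = exp (\<i> * complex_of_real (2 * pi * y))"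
    using assms by (simp add: cis_conv_exp)
  then obtain n :: int where "\<i> * complex_of_real (2 * pi * x) = \<i> * complex_of_real (2 * pi * y) + of_int (2 * n) * pi * \<i>"
    unfolding exp_eq by auto
  from arg_cong[OF this, of Im] have "2 * pi * x = 2 * pi * y + of_int (2 * n) * pi" by simp
  then have "pi * (2 * (x - y)) = pi * (2 * of_int n)"
    by (simp add: algebra_simps)
  then have "x - y = of_int n" by simp
  then show ?thesis by simp
qed

text \<open>The square roots combine to the character exp(2 pi i sum_j s_j p_j / d_j) of the finite
  group, as a function of integer vectors.\<close>

definition finite_char :: "('n \<Rightarrow> nat) \<Rightarrow> int^'n \<Rightarrow> int^'n \<Rightarrow> complex" where
  "finite_char d p s = cis (2 * pi * (D_neg_half d s \<bullet> D_neg_half d p))"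

text \<open>A unit vector in a coordinate where the labels differ separates them: equality would
  make \<open>d j\<close> divide a nonzero difference smaller than \<open>d j\<close>.\<close>

lemma finite_char_distinct:
  fixes p p' :: "int^'n::finite"
  assumes "p \<in> Zd d" "p' \<in> Zd d" "p \<noteq> p'"
  shows "\<exists>s. finite_char d p s \<noteq> finite_char d p' s"
proof -
  obtain j where j: "p $ j \<noteq> p' $ j" using assms(3) by (metis vec_eq_iff)
  let ?s = "axis j 1 :: int^'n"
  have dj: "0 < d j" using assms(1) by (auto simp: Zd_def dest!: spec[of _ j])
  have *: "D_neg_half d ?s \<bullet> D_neg_half d r = of_int (r $ j) / real (d j)" for r
  proof -
    have "D_neg_half d ?s \<bullet> D_neg_half d r = (\<Sum>i\<in>UNIV. if i = j then of_int (r $ j) / real (d j) else 0)"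
      unfolding inner_vec_def D_neg_half_def by (rule sum.cong) (auto simp: axis_def)
    then show ?thesis by simp
  qed
  have "finite_char d p ?s \<noteq> finite_char d p' ?s"
  proof
    assume "finite_char d p ?s = finite_char d p' ?s"
    then have "of_int (p $ j) / real (d j) - of_int (p' $ j) / real (d j) \<in> \<int>"
      unfolding finite_char_def * by (rule cis_eq_imp_Ints)
    then obtain n :: int where "of_int (p $ j) / real (d j) - of_int (p' $ j) / real (d j) = of_int n"
      by (auto elim: Ints_cases)
    then have "real_of_int (p $ j - p' $ j) = of_int (n * int (d j))"
      using dj by (simp add: field_simps)
    then have eq: "p $ j - p' $ j = n * int (d j)" by (simp only: of_int_eq_iff)
    have "\<bar>p $ j - p' $ j\<bar> < int (d j)"
      using assms(1,2) unfolding Zd_def by (smt (verit, best) mem_Collect_eq)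
    then have "n = 0" unfolding eq using dj by (auto simp: abs_mult)
    with eq j show False by simp
  qed
  then show ?thesis ..
qed

section \<open>The functional of a code vector, its nonvanishing and its stability\<close>

context
  fixes \<phi> :: "real^'n::finite \<Rightarrow> complex" and d :: "'n \<Rightarrow> nat"
  assumes \<phi>: "\<phi> \<in> schwartz" "\<phi> \<noteq> (\<lambda>t. 0)" and d: "\<And>j. d j > 0"
begin

lemma M1_abs_summable:
  assumes "h \<in> M1 \<phi>"
  shows "(\<lambda>\<gamma>. cmod (h (x - \<gamma>))) summable_on range (D_half d)"
proof -
  obtain m r where m: "r > 0" "m summable_on range (D_half d)"
    "\<And>\<gamma> s. \<gamma> \<in> range (D_half d) \<Longrightarrow> norm s < r \<Longrightarrow> cmod (h (x - \<gamma> + s)) \<le> m \<gamma>"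
    using M1_amalgam[OF \<phi>, of d, OF d] assms by meson
  show ?thesis
    using m(3)[of _ 0] m(1) by (intro summable_on_comparison_test[OF m(2)]) auto
qed

lemma zak_bound: "\<exists>C. \<forall>h\<in>M1 \<phi>. \<forall>x. cmod (zak d h x 0) \<le> C * M1_norm \<phi> h"
proof -
  obtain C r where A: "r > 0"
    "\<forall>h\<in>M1 \<phi>. \<forall>t0. \<exists>m. m summable_on range (D_half d) \<and> infsum m (range (D_half d)) \<le> C * M1_norm \<phi> h
        \<and> (\<forall>\<gamma>\<in>range (D_half d). \<forall>s. norm s < r \<longrightarrow> cmod (h (t0 - \<gamma> + s)) \<le> m \<gamma>)"
    using M1_amalgam[OF \<phi>, of d, OF d] by blast
  have "cmod (zak d h x 0) \<le> C * M1_norm \<phi> h" if h: "h \<in> M1 \<phi>" for h x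
  proof -
    obtain m where m: "m summable_on range (D_half d)" "infsum m (range (D_half d)) \<le> C * M1_norm \<phi> h"
      "\<And>\<gamma> s. \<gamma> \<in> range (D_half d) \<Longrightarrow> norm s < r \<Longrightarrow> cmod (h (x - \<gamma> + s)) \<le> m \<gamma>"
      using A(2) h by meson
    have "cmod (zak d h x 0) \<le> (\<Sum>\<^sub>\<infinity>\<gamma>\<in>range (D_half d). cmod (h (x - \<gamma>)))"
      unfolding zak_0 by (rule norm_infsum_bound[OF M1_abs_summable[OF h]])
    also have "\<dots> \<le> infsum m (range (D_half d))"
      using m(3)[of _ 0] A(1) by (intro infsum_mono M1_abs_summable[OF h] m(1)) auto
    finally show ?thesis using m(2) by linarith
  qed
  then show ?thesis by blast
qed

lemma zak_add:
  assumes "h \<in> M1 \<phi>" "k \<in> M1 \<phi>"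
  shows "zak d (\<lambda>t. h t + k t) x 0 = zak d h x 0 + zak d k x 0"
  unfolding zak_0
  by (rule infsum_add[OF abs_summable_summable[OF M1_abs_summable[OF assms(1)]]
        abs_summable_summable[OF M1_abs_summable[OF assms(2)]]])

lemma zak_scale: "zak d (\<lambda>t. a * h t) x 0 = a * zak d h x 0"
  unfolding zak_0 by (rule infsum_cmult_right')

lemma zak_sum:
  assumes "finite A" "\<And>s. s \<in> A \<Longrightarrow> g s \<in> M1 \<phi>"
  shows "zak d (\<lambda>t. \<Sum>s\<in>A. g s t) x 0 = (\<Sum>s\<in>A. zak d (g s) x 0)"
  using assms
proof (induction rule: finite_induct)
  case (insert a A)
  then show ?case
    using zak_add[of "g a" "\<lambda>t. \<Sum>s\<in>A. g s t" x] M1_sum[OF \<phi> insert.hyps(1), of g] by simp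
qed (simp add: zak_0)

lemma window_comb_M1:
  assumes "\<And>s. g s \<in> M1 \<phi>"
  shows "window_comb g \<alpha> \<in> M1 \<phi>"
  unfolding window_comb_def by (rule M1_sum[OF \<phi>]) (auto intro: M1_scale[OF \<phi>] assms)

text \<open>Linearity of the Zak transform on M^1 reduces the multi-window setting to the single
  window \<open>window_comb g \<alpha>\<close>.\<close>

lemma v_vec_eq:
  assumes "\<And>s. g s \<in> M1 \<phi>"
  shows "v_vec d g \<alpha> = zak_vec d (window_comb g \<alpha>) 0 0"
proof -
  have "zak d (window_comb g \<alpha>) x 0 = (\<Sum>s\<in>UNIV. cnj (\<alpha> $ s) * zak d (g s) x 0)" for x
    unfolding window_comb_def by (subst zak_sum) (auto intro: M1_scale[OF \<phi>] assms simp: zak_scale)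
  then show ?thesis
    by (auto simp: fun_eq_iff v_vec_def zak_vec_0)
qed

text \<open>Explicit candidate for \<open>psi\<close>, with the default 0 off M^1 that
  \<open>Minf\<close> prescribes.\<close>

definition zak_functional :: "(int^'n \<Rightarrow> complex) \<Rightarrow> (real^'n \<Rightarrow> complex) \<Rightarrow> complex" where
  "zak_functional c h = (if h \<in> M1 \<phi> then l2_inner (Zd d) c (zak_vec d h 0 0) else 0)"

lemma rho_M1_iff: "rho z h \<in> M1 \<phi> \<longleftrightarrow> h \<in> M1 \<phi>"
proof
  assume "rho z h \<in> M1 \<phi>"
  from M1_rho[OF \<phi> this, of "- z"] show "h \<in> M1 \<phi>"
    by (simp add: rho_rho sympl_def inner_commute)
qed (rule M1_rho[OF \<phi>])

text \<open>The existence half of the description of \<open>psi\<close>: the amalgam estimate gives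
  the norm bound, and covariance of the Zak vector gives the invariance.\<close>

lemma zak_functional_code_space: "zak_functional c \<in> code_space \<phi> d"
proof -
  obtain C where C: "\<And>h x. h \<in> M1 \<phi> \<Longrightarrow> cmod (zak d h x 0) \<le> C * M1_norm \<phi> h"
    using zak_bound by blast
  have "cmod (zak_functional c h) \<le> (\<Sum>p\<in>Zd d. cmod (c p)) * C * M1_norm \<phi> h" if h: "h \<in> M1 \<phi>" for h
  proof -
    have "cmod (zak_functional c h) \<le> (\<Sum>p\<in>Zd d. cmod (c p * cnj (zak_vec d h 0 0 p)))"
      using h unfolding zak_functional_def l2_inner_def by (simp only: if_True norm_sum)
    also have "\<dots> \<le> (\<Sum>p\<in>Zd d. cmod (c p) * (C * M1_norm \<phi> h))"
      using C[OF h] by (intro sum_mono) (auto simp: norm_mult zak_vec_0 intro!: mult_left_mono)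
    finally show ?thesis by (simp add: sum_distrib_right mult.assoc)
  qed
  moreover have "zak_functional c (\<lambda>t. h t + k t) = zak_functional c h + zak_functional c k"
    if "h \<in> M1 \<phi>" "k \<in> M1 \<phi>" for h k
    using that M1_add[OF \<phi> that]
    by (simp add: zak_functional_def l2_inner_def zak_vec_0 zak_add distrib_left sum.distrib)
  moreover have "zak_functional c (\<lambda>t. a * h t) = cnj a * zak_functional c h" if "h \<in> M1 \<phi>" for a h
    using that M1_scale[OF \<phi> that, of a]
    by (simp add: zak_functional_def l2_inner_def zak_vec_0 zak_scale sum_distrib_left mult.left_commute)
  moreover have "zak_functional c h = 0" if "h \<notin> M1 \<phi>" for h
    using that by (simp add: zak_functional_def)
  ultimately have F: "zak_functional c \<in> Minf \<phi>"
    unfolding Minf_def by blast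
  have "chi d l * rho_dual l (zak_functional c) h = zak_functional c h" if l: "l \<in> Lat d" for l h
  proof -
    have chi: "chi d (- l) = chi d l"
      by (simp add: chi_eq_cis[of d, OF d] l uminus_Lat)
    have cc: "chi d l * cnj (chi d l) = 1"
      by (simp add: chi_eq_cis[of d, OF d l] cis_cnj cis_mult)
    \<comment> \<open>The sign comes out conjugated because the pairing is conjugate-linear in
      \<open>h\<close>; being unimodular, it cancels against the factor
      \<open>chi d l\<close>.\<close>
    have "zak_functional c (rho (- l) h) = cnj (chi d l) * zak_functional c h"
      unfolding zak_functional_def rho_M1_iff
      by (simp add: l2_inner_def zak_vec_rho_Lat[of d, OF d uminus_Lat[OF l]] chi sum_distrib_left mult_ac)
    then show ?thesis by (simp add: rho_dual_def mult.assoc[symmetric] cc)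
  qed
  with F show ?thesis by (auto simp: code_space_def)
qed

lemma psi_eq: "psi \<phi> d c = zak_functional c"
  unfolding psi_def
proof (rule the_equality)
  show "zak_functional c \<in> code_space \<phi> d \<and> (\<forall>h\<in>M1 \<phi>. zak_functional c h = l2_inner (Zd d) c (zak_vec d h 0 0))"
    using zak_functional_code_space by (simp add: zak_functional_def)
next
  fix F assume "F \<in> code_space \<phi> d \<and> (\<forall>h\<in>M1 \<phi>. F h = l2_inner (Zd d) c (zak_vec d h 0 0))"
  then show "F = zak_functional c"
    by (auto simp: zak_functional_def code_space_def Minf_def fun_eq_iff)
qed

text \<open>If all values vanished, then for each \<open>r\<close> a combination of the distinct
  characters \<open>finite_char d p\<close> would vanish, so each coefficient
  \<open>cnj (c p)\<close> times the Zak value at \<open>p - r\<close> would be 0. One nonzero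
  \<open>c p\<close> then kills the whole Zak vector.\<close>

lemma zak_functional_nonzero:
  assumes rep: "representatives d rep" and h: "h \<in> M1 \<phi>" "zak_vec d h 0 0 \<noteq> (\<lambda>r. 0)"
    and c: "p \<in> Zd d" "c p \<noteq> 0"
  shows "\<exists>q\<in>KD d. zak_functional c (rho (nu d rep q) h) \<noteq> 0"
proof (rule ccontr)
  assume "\<not> ?thesis"
  then have zero: "zak_functional c (rho (nu d rep q) h) = 0" if "q \<in> KD d" for q
    using that by blast
  have per: "zak d h (D_neg_half d (a + (\<chi> j. int (d j) * k $ j))) 0 = zak d h (D_neg_half d a) 0" for a k
    unfolding D_neg_half_add D_neg_half_multiple by (rule zak_periodic)
  have char_per: "finite_char d p (s + (\<chi> j. int (d j) * k $ j)) = finite_char d p s" for p s k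
    unfolding finite_char_def D_neg_half_add D_neg_half_multiple inner_add_left distrib_left
    by (rule cis_add_Ints[OF D_half_inner_neg_half[of d, OF d]])
  have cong: "\<exists>k. b = a + (\<chi> j. int (d j) * k $ j)" if "\<And>j. b $ j mod int (d j) = a $ j mod int (d j)" for a b :: "int^'n"
  proof -
    have "\<exists>k. b $ j = a $ j + int (d j) * k" for j
      using that[of j] by (metis mod_eqE add.commute diff_add_cancel mod_eq_dvd_iff dvd_def)
    then obtain k where "\<And>j. b $ j = a $ j + int (d j) * k j" by metis
    then have "b = a + (\<chi> j. int (d j) * (\<chi> j. k j) $ j)" by (simp add: vec_eq_iff)
    then show ?thesis by blast
  qed
  \<comment> \<open>Periodicity extends the relation from the chosen representatives to all integer
    vectors \<open>r\<close> and \<open>s\<close>; the shift \<open>p - t\<close> used below need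
    not be a label.\<close>
  have van: "(\<Sum>p\<in>Zd d. (cnj (c p) * zak d h (D_neg_half d (p - r)) 0) * finite_char d p s) = 0" for r s
  proof -
    define q where "q = ((\<chi> j. r $ j mod int (d j)), (\<chi> j. s $ j mod int (d j)))"
    have q: "q \<in> KD d" using d by (simp add: q_def KD_def Zd_def)
    have "fst (rep q) $ j mod int (d j) = r $ j mod int (d j)"
      "snd (rep q) $ j mod int (d j) = s $ j mod int (d j)" for j
      using rep q unfolding representatives_def by (auto simp: q_def)
    then obtain k l where kl: "r = fst (rep q) + (\<chi> j. int (d j) * k $ j)"
      "snd (rep q) = s + (\<chi> j. int (d j) * l $ j)"
      using cong[of r "fst (rep q)"] cong[of "snd (rep q)" s] by metis
    let ?z = "nu d rep q"
    have z: "fst ?z = D_neg_half d (fst (rep q))" "snd ?z = D_neg_half d (snd (rep q))"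
      by (simp_all add: nu_def)
    \<comment> \<open>This phase does not depend on \<open>p\<close>, so it can be divided out of
      the sum.\<close>
    let ?\<theta> = "cis (- (pi * (fst ?z \<bullet> snd ?z)))"
    have "zak d (rho ?z h) (D_neg_half d p) 0
        = ?\<theta> * (finite_char d p s * zak d h (D_neg_half d (p - r)) 0)" for p
    proof -
      have "zak d h (D_neg_half d p - fst ?z) 0 = zak d h (D_neg_half d (p - r)) 0"
        using per[of "p - r" k] by (simp add: z kl(1) D_neg_half_diff D_neg_half_add)
      moreover have "cis (2 * pi * (snd ?z \<bullet> D_neg_half d p)) = finite_char d p s"
        using char_per[of p s l] by (simp add: z kl(2) finite_char_def)
      moreover have "snd ?z \<bullet> D_half d k \<in> \<int>" for k
        unfolding z using D_half_inner_neg_half[of d, OF d] by (simp add: inner_commute)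
      ultimately show ?thesis
        by (simp only: zak_rho cis_mult[symmetric] mult.assoc)
    qed
    then have "zak_functional c (rho ?z h)
        = (\<Sum>p\<in>Zd d. c p * cnj (?\<theta> * (finite_char d p s * zak d h (D_neg_half d (p - r)) 0)))"
      using h(1) by (simp add: zak_functional_def rho_M1_iff l2_inner_def zak_vec_0)
    also have "\<dots> = cnj (?\<theta> * (\<Sum>p\<in>Zd d. (cnj (c p) * zak d h (D_neg_half d (p - r)) 0) * finite_char d p s))"
      by (simp add: sum_distrib_left mult_ac)
    finally show ?thesis
      unfolding zero[OF q] by (simp only: complex_cnj_zero_iff mult_eq_0_iff cis_neq_zero eq_commute[of 0] simp_thms)
  qed
  have "zak d h (D_neg_half d t) 0 = 0" for t
  proof -
    \<comment> \<open>With the shift \<open>p - t\<close>, the coefficient at the index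
      \<open>p\<close>, where \<open>c p\<close> is nonzero, contains the Zak value at
      \<open>t\<close>.\<close>
    have "cnj (c p) * zak d h (D_neg_half d (p - (p - t))) 0 = 0"
    proof (rule characters_independent[where X = "finite_char d" and A = "Zd d"
          and u = "\<lambda>p'. cnj (c p') * zak d h (D_neg_half d (p' - (p - t))) 0"])
      show "finite_char d p (s + t) = finite_char d p s * finite_char d p t" for p s t
        by (simp add: finite_char_def D_neg_half_add inner_add_left distrib_left cis_mult)
      show "finite_char d p 0 = 1" for p
        by (simp add: finite_char_def inner_vec_def D_neg_half_def)
    qed (use finite_char_distinct van c finite_Zd in auto)
    then show ?thesis using c by simp
  qed
  then have "zak_vec d h 0 0 = (\<lambda>r. 0)" by (simp add: fun_eq_iff zak_vec_0)
  with h(2) show False ..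
qed

text \<open>Weierstrass test: modulation does not change the modulus, so the displacement acts only
  through \<open>fst \<zeta>\<close>, and the amalgam majorant dominates all terms near the
  origin.\<close>

lemma zak_rho_continuous:
  assumes h: "h \<in> M1 \<phi>"
  obtains r where "r > 0" "continuous_on (ball 0 r) (\<lambda>\<zeta>. zak d (rho (- \<zeta>) h) x 0)"
proof -
  let ?\<Gamma> = "range (D_half d)"
  obtain m r where m: "r > 0" "m summable_on ?\<Gamma>"
    "\<And>\<gamma> s. \<gamma> \<in> ?\<Gamma> \<Longrightarrow> norm s < r \<Longrightarrow> cmod (h (x - \<gamma> + s)) \<le> m \<gamma>"
    using M1_amalgam[OF \<phi>, of d, OF d] assms by meson
  have hc: "continuous_on UNIV h" using h by (simp add: M1_def)
  have "uniform_limit (ball 0 r) (\<lambda>F \<zeta>. \<Sum>\<gamma>\<in>F. rho (- \<zeta>) h (x - \<gamma>))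
      (\<lambda>\<zeta>. \<Sum>\<^sub>\<infinity>\<gamma>\<in>?\<Gamma>. rho (- \<zeta>) h (x - \<gamma>)) (finite_subsets_at_top ?\<Gamma>)"
  proof (rule Weierstrass_m_test_general[OF _ m(2)])
    fix \<gamma> and \<zeta> :: "'n phase" assume "\<gamma> \<in> ?\<Gamma>" "\<zeta> \<in> ball 0 r"
    moreover have "norm (fst \<zeta>) \<le> norm \<zeta>" using norm_fst_le[of "fst \<zeta>" "snd \<zeta>"] by simp
    ultimately show "norm (rho (- \<zeta>) h (x - \<gamma>)) \<le> m \<gamma>"
      using m(3)[of \<gamma> "fst \<zeta>"] by (simp add: cmod_rho)
  qed
  moreover have "continuous_on (ball 0 r) (\<lambda>\<zeta>. \<Sum>\<gamma>\<in>F. rho (- \<zeta>) h (x - \<gamma>))" for F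
    unfolding rho_altdef
    by (intro continuous_intros continuous_on_compose2[OF hc]) auto
  ultimately have "continuous_on (ball 0 r) (\<lambda>\<zeta>. \<Sum>\<^sub>\<infinity>\<gamma>\<in>?\<Gamma>. rho (- \<zeta>) h (x - \<gamma>))"
    by (intro uniform_limit_theorem[rotated]) auto
  with m(1) that show thesis unfolding zak_0 by blast
qed

lemma zak_functional_stable:
  assumes h: "h \<in> M1 \<phi>" and nz: "zak_functional c h \<noteq> 0"
  shows "\<exists>\<epsilon>>0. \<forall>\<zeta>. norm \<zeta> < \<epsilon> \<longrightarrow> zak_functional c (rho (- \<zeta>) h) \<noteq> 0"
proof -
  \<comment> \<open>The radius may vary with \<open>p\<close>; continuity at the origin passes to
    the finite sum over \<open>Zd d\<close>.\<close>
  have "\<exists>r>0. continuous_on (ball 0 r) (\<lambda>\<zeta>. zak d (rho (- \<zeta>) h) (D_neg_half d p) 0)" for p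
    using zak_rho_continuous[OF h] by metis
  then obtain r where r: "\<And>p. r p > 0"
    "\<And>p. continuous_on (ball 0 (r p)) (\<lambda>\<zeta>. zak d (rho (- \<zeta>) h) (D_neg_half d p) 0)"
    by metis
  have "isCont (\<lambda>\<zeta>. zak d (rho (- \<zeta>) h) (D_neg_half d p) 0) 0" for p
    using r by (auto simp: continuous_on_eq_continuous_at)
  then have "isCont (\<lambda>\<zeta>. \<Sum>p\<in>Zd d. c p * cnj (zak d (rho (- \<zeta>) h) (D_neg_half d p) 0)) 0"
    by (intro continuous_intros)
  moreover have eq: "zak_functional c (rho (- \<zeta>) h)
      = (\<Sum>p\<in>Zd d. c p * cnj (zak d (rho (- \<zeta>) h) (D_neg_half d p) 0))" for \<zeta>
    using h by (simp add: zak_functional_def rho_M1_iff l2_inner_def zak_vec_0)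
  ultimately have "isCont (\<lambda>\<zeta>. zak_functional c (rho (- \<zeta>) h)) 0" by simp
  from continuous_at_avoid[OF this, of 0] nz
  obtain e where "e > 0" "\<forall>\<zeta>. dist 0 \<zeta> < e \<longrightarrow> zak_functional c (rho (- \<zeta>) h) \<noteq> 0" by auto
  then show ?thesis by (auto simp: dist_norm)
qed

text \<open>One entry of the block that is nonzero at \<open>\<zeta> = 0\<close> stays nonzero
  nearby by continuity.\<close>

lemma block_stable:
  assumes rep: "representatives d rep" and g: "\<And>s. g s \<in> M1 \<phi>" and v: "v_vec d g \<alpha> \<noteq> (\<lambda>r. 0)"
    and nz: "psi \<phi> d c \<noteq> (\<lambda>h. 0)"
  shows "\<exists>\<epsilon>>0. \<forall>\<zeta>. norm \<zeta> < \<epsilon> \<longrightarrow> block d rep g \<alpha> \<zeta> (psi \<phi> d c) 0 \<noteq> (\<lambda>q. 0)"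
proof -
  let ?h = "window_comb g \<alpha>"
  have h: "?h \<in> M1 \<phi>" by (rule window_comb_M1[OF g])
  from nz obtain k where "zak_functional c k \<noteq> 0" unfolding psi_eq fun_eq_iff by blast
  then have "l2_inner (Zd d) c (zak_vec d k 0 0) \<noteq> 0"
    by (auto simp: zak_functional_def split: if_splits)
  then obtain p where p: "p \<in> Zd d" "c p \<noteq> 0"
    unfolding l2_inner_def by (auto elim!: sum.not_neutral_contains_not_neutral)
  obtain q where q: "q \<in> KD d" "zak_functional c (rho (nu d rep q) ?h) \<noteq> 0"
    using zak_functional_nonzero[where rep = rep and h = ?h and c = c and p = p] rep h v p by (auto simp: v_vec_eq[OF g])
  obtain \<epsilon> where \<epsilon>: "\<epsilon> > 0"
    "\<And>\<zeta>. norm \<zeta> < \<epsilon> \<Longrightarrow> zak_functional c (rho (- \<zeta>) (rho (nu d rep q) ?h)) \<noteq> 0"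
    using zak_functional_stable[OF M1_rho[OF \<phi> h] q(2)] by blast
  \<comment> \<open>Ensures that the normalizing factor of the block is not a division by 0.\<close>
  obtain r where "v_vec d g \<alpha> r \<noteq> 0" using v unfolding fun_eq_iff by blast
  then have "l2_norm (Zd d) (v_vec d g \<alpha>) \<noteq> 0"
    unfolding l2_norm_eq_0[OF finite_Zd] v_vec_eq[OF g] by (auto simp: zak_vec_0 split: if_splits)
  moreover have "d j \<noteq> 0" for j using d[of j] by simp
  ultimately have *: "block d rep g \<alpha> \<zeta> (psi \<phi> d c) 0 q \<noteq> 0" if "norm \<zeta> < \<epsilon>" for \<zeta>
    using \<epsilon>(2)[OF that] q(1) by (simp add: block_def adj_coeff_def rho_dual_def psi_eq)
  show ?thesis
  proof (intro exI conjI allI impI notI)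
    show "\<epsilon> > 0" by fact
    fix \<zeta> assume "norm \<zeta> < \<epsilon>" "block d rep g \<alpha> \<zeta> (psi \<phi> d c) 0 = (\<lambda>q. 0)"
    then show False using *[of \<zeta>] by simp
  qed
qed

end

theorem corollary7p3:
  fixes d :: "'n::{finite,linorder} \<Rightarrow> nat"
    and \<phi> :: "(real, 'n) vec \<Rightarrow> complex"
    and g :: "'m::finite \<Rightarrow> (real, 'n) vec \<Rightarrow> complex"
    and \<alpha> :: "complex^'m"
    and rep :: "(int, 'n) vec \<times> (int, 'n) vec \<Rightarrow> (int, 'n) vec \<times> (int, 'n) vec"
  assumes "\<phi> \<in> schwartz" and "\<phi> \<noteq> (\<lambda>t. 0)"
    and "\<And>j. d j > 0" and "\<And>i j. i \<le> j \<Longrightarrow> d i dvd d j"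
    and "representatives d rep"
    and "\<And>s. g s \<in> M1 \<phi>" and "gabor_frame d g"
    and "v_vec d g \<alpha> \<noteq> (\<lambda>r. 0)"
  shows "(\<forall>f\<in>code_space \<phi> d. \<forall>\<zeta>. block d rep g \<alpha> \<zeta> f 0 \<noteq> (\<lambda>q. 0) \<longrightarrow>
           (\<forall>l\<in>Lat d.
              l2_inner (KD d) (block d rep g \<alpha> \<zeta> f l) (block d rep g \<alpha> \<zeta> f 0)
                / of_real ((l2_norm (KD d) (block d rep g \<alpha> \<zeta> f 0))\<^sup>2)
              = chi d l * cis (2 * pi * sympl l \<zeta>))) \<and>
         (\<forall>c\<in>Hd d. psi \<phi> d c \<noteq> (\<lambda>h. 0) \<longrightarrow>
           (\<exists>\<epsilon>>0. \<forall>\<zeta>. norm \<zeta> < \<epsilon> \<longrightarrow> block d rep g \<alpha> \<zeta> (psi \<phi> d c) 0 \<noteq> (\<lambda>q. 0)))"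
proof (intro conjI ballI allI impI)
  fix f \<zeta> l
  assume "f \<in> code_space \<phi> d" "block d rep g \<alpha> \<zeta> f 0 \<noteq> (\<lambda>q. 0)" "l \<in> Lat d"
  then show "l2_inner (KD d) (block d rep g \<alpha> \<zeta> f l) (block d rep g \<alpha> \<zeta> f 0)
      / of_real ((l2_norm (KD d) (block d rep g \<alpha> \<zeta> f 0))\<^sup>2) = chi d l * cis (2 * pi * sympl l \<zeta>)"
    using assms(3) by (intro block_ratio)
next
  fix c assume "psi \<phi> d c \<noteq> (\<lambda>h. 0)"
  then show "\<exists>\<epsilon>>0. \<forall>\<zeta>. norm \<zeta> < \<epsilon> \<longrightarrow> block d rep g \<alpha> \<zeta> (psi \<phi> d c) 0 \<noteq> (\<lambda>q. 0)"
    by (rule block_stable[of \<phi> d, OF assms(1-3,5,6,8)])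
qed

end
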